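(* Let $\sigma$ be a primitive Pisot substitution over the letters $\{1,\dots,m\}$, let $\beta$ be the Perron–Frobenius root of its substitution matrix, and let $\mathcal{T}$ be the canonical suspension tiling of $\mathbb{R}$ of $\sigma$ with expansion factor $\beta$, taken to be a fixed point of the associated tile substitution $\Omega$. Then there is a positive integer $n$, depending only on $\mathcal{T}$, such that $\mathcal{T}$ satisfies multiple strong coincidence of level $n$ if and only if $\mathcal{T}$ satisfies overlap coincidence.
   Context: **Pisot substitution and suspension tiling.** A substitution $\sigma$ over $\{1,\dots,m\}$ maps each letter to a non-empty finite word. Its substitution matrix is $M_\sigma=(|\sigma(j)|_i)_{i,j}$, where $|w|_i$ is the number of occurrences of the letter $i$ in the word $w$; $\sigma$ is primitive if $M_\sigma$ is primitive. $\sigma$ is a Pisot substitution if the Perron–Frobenius root $\beta$ of $M_\sigma$ is a Pisot number (a real algebraic integer $>1$ all of whose other conjugates have modulus $<1$). Let $(l_1,\dots,l_m)$ be a positive left eigenvector of $M_\sigma$ for $\beta$. The canonical suspension tiling associates to the letter $i$ the prototile $T_i=([0,l_i],i)$; the associated tile substitution $\Omega$ has expansion $Q=(\beta)$ and maps $T_j$ to the patch subdividing $[0,\beta l_j]$ from left to right into translates of the prototiles $T_{i_1},\dots,T_{i_r}$, where $\sigma(j)=i_1\cdots i_r$; it extends to translates by $\Omega(T_j+x)=\Omega(T_j)+\beta x$ and to patches and tilings tile by tile. The suspension tiling $\mathcal{T}$ is a tiling of $\mathbb{R}$ by translates of $T_1,\dots,T_m$ with $\Omega(\mathcal{T})=\mathcal{T}$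 such that every patch (finite collection of tiles) of $\mathcal{T}$ is, up to translation, a sub-patch of $\Omega^k(T)$ for some $k\in\mathbb{N}$, $T\in\mathcal{T}$. For a tile $T=(A,i)$ write $\operatorname{supp}(T)=A$, $\ell(T)=i$ (color), $g+T=(g+A,i)$. **Return vectors and overlap coincidence.** $\Xi(\mathcal{T})=\{y\in\mathbb{R} : U=V-y \text{ for some } U,V\in\mathcal{T}\}$. An overlap is a triple $(U,y,V)$ with $U,V\in\mathcal{T}$, $y\in\Xi(\mathcal{T})$ and $(\operatorname{supp}(U))^\circ\cap(\operatorname{supp}(V)-y)^\circ\ne\emptyset$. It is a coincidence if $U=V-y$. For an overlap $\mathcal{O}=(U,y,V)$ and $\ell\ge1$ put $\Omega^\ell\mathcal{O}=\{(U',Q^\ell y,V') : U'\in\Omega^\ell(U),\ V'\in\Omega^\ell(V),\ (U',Q^\ell y,V')\text{ is an overlap}\}$. $\mathcal{T}$ satisfies overlap coincidence if there exists $\ell\in\mathbb{Z}_{+}$ such that $\Omega^\ell\mathcal{O}$ contains a coincidence for every overlap $\mathcal{O}$ in $\mathcal{T}$. **Control points.** Let $n\ge1$; note $\Omega^n(\mathcal{T})=\mathcal{T}$. A tile map of $\Omega^n$ is a map $\gamma=\gamma_{\Omega^n}:\mathcal{T}\to\mathcal{T}$ sending each tile $T$ to a tile of $\Omega^n(T)$, such that $\gamma(T)$ and $\gamma(T')$ are in the same relative position in $\Omega^n(T)$ and $\Omega^n(T')$ whenever $\ell(T)=\ell(T')$ (i.e. if $T'=T+x$ then $\gamma(T')=\gamma(T)+Q^nx$).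 The control point $c(T)$ of $T\in\mathcal{T}$ (for $\Omega^n$ and $\gamma$) is the unique point of $\bigcap_{k=1}^\infty Q^{-nk}\operatorname{supp}(\gamma^k(T))$; tiles $T$ of the same color have the same $T-c(T)$, and $c$ is extended to all translates of prototiles by $c(T+x)=c(T)+x$. Put $\Lambda_i=\{c(T) : T\in\mathcal{T},\ \ell(T)=i\}$, $\boldsymbol{\Lambda}=(\Lambda_i)_{i\le m}$ (the associated Delone multi-color set) and $\Lambda=\bigcup_{i=1}^m\Lambda_i$. The control points are admissible if $\bigcap_{i\le m}(\operatorname{supp}(T_i)-c(T_i))$ has non-empty interior. For admissible control points, $\boldsymbol{\Lambda}$ admits strong coincidence if for all $1\le i,j\le m$ there is a positive integer $L$ with $\Omega^L(T_i-c(T_i))\cap\Omega^L(T_j-c(T_j))\neq\emptyset$ (i.e. these two patches share a common tile). **Multiple strong coincidence.** Let $\mathcal{G}=\bigcup_{k=0}^\infty Q^{-k}(\Lambda_i-\Lambda_i)$ for some $i\le m$ (it is independent of $i$ by primitivity, and $\Lambda_i-\Lambda_i$ does not depend on the choice of control points), and let $\langle\mathcal{G}\rangle$ be the additive subgroup of $\mathbb{R}$ generated by $\mathcal{G}$. $\mathcal{T}$ satisfies multiple strong coincidence of level $n$ if every $\boldsymbol{\Lambda}$ generated by admissible control points of $\Omega^n$ (over all choices of tile map of $\Omega^n$) with $\Lambda-\Lambda\subset\langle\mathcal{G}\rangle$ admits strong coincidence. *)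

theory Defs
  imports
    "HOL-Analysis.Analysis"
    "HOL-Computational_Algebra.Computational_Algebra"
begin

section \<open>Primitive Pisot substitutions\<close>

text \<open>The letters are the elements of a finite type.\<close>

type_synonym 'a subst = "'a \<Rightarrow> 'a list"

definition substitution :: "'a subst \<Rightarrow> bool" where
  "substitution \<sigma> \<longleftrightarrow> (\<forall>j. \<sigma> j \<noteq> [])"

definition subst_matrix :: "'a::finite subst \<Rightarrow> real^'a^'a" where
  "subst_matrix \<sigma> = (\<chi> i j. real (count_list (\<sigma> j) i))"

text \<open>Powers are iterated matrix products; the operation \<open>^\<close> on matrices would act entrywise.\<close>

definition primitive_matrix :: "real^'a^'a \<Rightarrow> bool" where
  "primitive_matrix M \<longleftrightarrow> (\<exists>k\<ge>1. \<forall>i j. 0 < (((**) M ^^ k) (mat 1)) $ i $ j)"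

definition complex_eigenvalue :: "real^'a^'a \<Rightarrow> complex \<Rightarrow> bool" where
  "complex_eigenvalue M z \<longleftrightarrow>
     (\<exists>v. v \<noteq> 0 \<and> map_matrix complex_of_real M *v v = z *s v)"

text \<open>The real eigenvalue that equals the spectral radius.\<close>

definition perron_root :: "real^'a^'a \<Rightarrow> real \<Rightarrow> bool" where
  "perron_root M \<beta> \<longleftrightarrow>
     complex_eigenvalue M (of_real \<beta>) \<and> (\<forall>z. complex_eigenvalue M z \<longrightarrow> cmod z \<le> \<beta>)"

text \<open>Conjugates are the complex roots of the minimal polynomial over the rationals, which is
  unique up to a constant factor among the irreducible polynomials vanishing at \<open>x\<close>.\<close>

definition conjugate_of :: "real \<Rightarrow> complex \<Rightarrow> bool" where
  "conjugate_of x z \<longleftrightarrow>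
     (\<exists>p :: rat poly. irreducible p \<and> poly (map_poly of_rat p) x = 0
                    \<and> poly (map_poly of_rat p) z = 0)"

definition pisot_number :: "real \<Rightarrow> bool" where
  "pisot_number \<beta> \<longleftrightarrow> algebraic_int \<beta> \<and> 1 < \<beta> \<and>
     (\<forall>z. conjugate_of \<beta> z \<and> z \<noteq> of_real \<beta> \<longrightarrow> cmod z < 1)"

section \<open>Suspension tilings\<close>

type_synonym 'a tile = "real set \<times> 'a"

abbreviation supp :: "'a tile \<Rightarrow> real set" where "supp \<equiv> fst"
abbreviation color :: "'a tile \<Rightarrow> 'a" where "color \<equiv> snd"

definition shift :: "real \<Rightarrow> 'a tile \<Rightarrow> 'a tile" where
  "shift x T = ((+) x ` supp T, color T)"

definition proto :: "real^'a \<Rightarrow> 'a \<Rightarrow> 'a tile" where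
  "proto l i = ({0..l $ i}, i)"

definition subst_proto :: "'a::finite subst \<Rightarrow> real^'a \<Rightarrow> 'a \<Rightarrow> 'a tile set" where
  "subst_proto \<sigma> l j =
     {shift (\<Sum>h<k. l $ (\<sigma> j ! h)) (proto l (\<sigma> j ! k)) |k. k < length (\<sigma> j)}"

text \<open>For a translate \<open>T\<close> of a prototile the shift \<open>x\<close> below is unique.\<close>

definition subst_tile ::
    "'a::finite subst \<Rightarrow> real \<Rightarrow> real^'a \<Rightarrow> 'a tile \<Rightarrow> 'a tile set" where
  "subst_tile \<sigma> \<beta> l T =
     {shift (\<beta> * x) U |x U. T = shift x (proto l (color T)) \<and> U \<in> subst_proto \<sigma> l (color T)}"

definition tile_subst ::
    "'a::finite subst \<Rightarrow> real \<Rightarrow> real^'a \<Rightarrow> 'a tile set \<Rightarrow> 'a tile set" where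
  "tile_subst \<sigma> \<beta> l P = (\<Union>T\<in>P. subst_tile \<sigma> \<beta> l T)"

definition tiling :: "real^'a \<Rightarrow> 'a tile set \<Rightarrow> bool" where
  "tiling l \<T> \<longleftrightarrow>
     (\<forall>T\<in>\<T>. \<exists>x i. T = shift x (proto l i)) \<and>
     (\<Union>T\<in>\<T>. supp T) = UNIV \<and>
     (\<forall>T\<in>\<T>. \<forall>U\<in>\<T>. T \<noteq> U \<longrightarrow> interior (supp T) \<inter> interior (supp U) = {})"

definition suspension_tiling ::
    "'a::finite subst \<Rightarrow> real \<Rightarrow> real^'a \<Rightarrow> 'a tile set \<Rightarrow> bool" where
  "suspension_tiling \<sigma> \<beta> l \<T> \<longleftrightarrow>
     tiling l \<T> \<and> tile_subst \<sigma> \<beta> l \<T> = \<T> \<and>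
     (\<forall>P. finite P \<and> P \<subseteq> \<T> \<longrightarrow>
        (\<exists>k. \<exists>T\<in>\<T>. \<exists>x. shift x ` P \<subseteq> (tile_subst \<sigma> \<beta> l ^^ k) {T}))"

section \<open>Overlap coincidence\<close>

definition return_vectors :: "'a tile set \<Rightarrow> real set" where
  "return_vectors \<T> = {y. \<exists>U\<in>\<T>. \<exists>V\<in>\<T>. U = shift (- y) V}"

definition overlaps :: "'a tile set \<Rightarrow> ('a tile \<times> real \<times> 'a tile) set" where
  "overlaps \<T> = {(U, y, V). U \<in> \<T> \<and> V \<in> \<T> \<and> y \<in> return_vectors \<T> \<and>
     interior (supp U) \<inter> interior (supp (shift (- y) V)) \<noteq> {}}"

fun coincidence :: "'a tile \<times> real \<times> 'a tile \<Rightarrow> bool" where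
  "coincidence (U, y, V) \<longleftrightarrow> U = shift (- y) V"

fun subst_overlap ::
    "'a::finite subst \<Rightarrow> real \<Rightarrow> real^'a \<Rightarrow> 'a tile set \<Rightarrow> nat
      \<Rightarrow> 'a tile \<times> real \<times> 'a tile \<Rightarrow> ('a tile \<times> real \<times> 'a tile) set" where
  "subst_overlap \<sigma> \<beta> l \<T> k (U, y, V) =
     {(U', \<beta> ^ k * y, V') |U' V'.
        U' \<in> (tile_subst \<sigma> \<beta> l ^^ k) {U} \<and> V' \<in> (tile_subst \<sigma> \<beta> l ^^ k) {V} \<and>
        (U', \<beta> ^ k * y, V') \<in> overlaps \<T>}"

definition overlap_coincidence ::
    "'a::finite subst \<Rightarrow> real \<Rightarrow> real^'a \<Rightarrow> 'a tile set \<Rightarrow> bool" where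
  "overlap_coincidence \<sigma> \<beta> l \<T> \<longleftrightarrow>
     (\<exists>k\<ge>1. \<forall>ov\<in>overlaps \<T>. \<exists>ov'\<in>subst_overlap \<sigma> \<beta> l \<T> k ov. coincidence ov')"

section \<open>Control points\<close>

text \<open>A tile map is represented by a function on all tiles; only its values on \<open>\<T>\<close> matter.\<close>

definition tile_map ::
    "'a::finite subst \<Rightarrow> real \<Rightarrow> real^'a \<Rightarrow> 'a tile set \<Rightarrow> nat \<Rightarrow> ('a tile \<Rightarrow> 'a tile) \<Rightarrow> bool" where
  "tile_map \<sigma> \<beta> l \<T> n \<gamma> \<longleftrightarrow>
     (\<forall>T\<in>\<T>. \<gamma> T \<in> \<T> \<and> \<gamma> T \<in> (tile_subst \<sigma> \<beta> l ^^ n) {T}) \<and>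
     (\<forall>T\<in>\<T>. \<forall>T'\<in>\<T>. \<forall>x. T' = shift x T \<longrightarrow> \<gamma> T' = shift (\<beta> ^ n * x) (\<gamma> T))"

text \<open>\<open>tiling_control_point\<close> is the control point of a tile of \<open>\<T>\<close>; \<open>control_point\<close> extends it to
  all translates of prototiles.\<close>

definition tiling_control_point :: "real \<Rightarrow> nat \<Rightarrow> ('a tile \<Rightarrow> 'a tile) \<Rightarrow> 'a tile \<Rightarrow> real" where
  "tiling_control_point \<beta> n \<gamma> T =
     (THE p. p \<in> (\<Inter>k\<in>{1..}. (\<lambda>t. t / \<beta> ^ (n * k)) ` supp ((\<gamma> ^^ k) T)))"

definition control_point ::
    "real \<Rightarrow> 'a tile set \<Rightarrow> nat \<Rightarrow> ('a tile \<Rightarrow> 'a tile) \<Rightarrow> 'a tile \<Rightarrow> real" where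
  "control_point \<beta> \<T> n \<gamma> T =
     (THE p. \<exists>T'\<in>\<T>. \<exists>x. T = shift x T' \<and> p = tiling_control_point \<beta> n \<gamma> T' + x)"

text \<open>The set \<open>\<Lambda>\<^sub>i\<close>.\<close>

definition color_points ::
    "real \<Rightarrow> 'a tile set \<Rightarrow> nat \<Rightarrow> ('a tile \<Rightarrow> 'a tile) \<Rightarrow> 'a \<Rightarrow> real set" where
  "color_points \<beta> \<T> n \<gamma> i = {control_point \<beta> \<T> n \<gamma> T |T. T \<in> \<T> \<and> color T = i}"

text \<open>The tile \<open>T\<^sub>i - c(T\<^sub>i)\<close>.\<close>

definition centered_proto ::
    "real \<Rightarrow> real^'a \<Rightarrow> 'a tile set \<Rightarrow> nat \<Rightarrow> ('a tile \<Rightarrow> 'a tile) \<Rightarrow> 'a \<Rightarrow> 'a tile" where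
  "centered_proto \<beta> l \<T> n \<gamma> i = shift (- control_point \<beta> \<T> n \<gamma> (proto l i)) (proto l i)"

definition admissible ::
    "real \<Rightarrow> real^'a \<Rightarrow> 'a tile set \<Rightarrow> nat \<Rightarrow> ('a tile \<Rightarrow> 'a tile) \<Rightarrow> bool" where
  "admissible \<beta> l \<T> n \<gamma> \<longleftrightarrow> interior (\<Inter>i. supp (centered_proto \<beta> l \<T> n \<gamma> i)) \<noteq> {}"

definition strong_coincidence ::
    "'a::finite subst \<Rightarrow> real \<Rightarrow> real^'a \<Rightarrow> 'a tile set \<Rightarrow> nat \<Rightarrow> ('a tile \<Rightarrow> 'a tile) \<Rightarrow> bool" where
  "strong_coincidence \<sigma> \<beta> l \<T> n \<gamma> \<longleftrightarrow>
     (\<forall>i j. \<exists>L\<ge>1. (tile_subst \<sigma> \<beta> l ^^ L) {centered_proto \<beta> l \<T> n \<gamma> i} \<inter>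
                 (tile_subst \<sigma> \<beta> l ^^ L) {centered_proto \<beta> l \<T> n \<gamma> j} \<noteq> {})"

section \<open>Multiple strong coincidence\<close>

definition return_generators ::
    "real \<Rightarrow> 'a tile set \<Rightarrow> nat \<Rightarrow> ('a tile \<Rightarrow> 'a tile) \<Rightarrow> 'a \<Rightarrow> real set" where
  "return_generators \<beta> \<T> n \<gamma> i =
     (\<Union>k. {(x - y) / \<beta> ^ k |x y. x \<in> color_points \<beta> \<T> n \<gamma> i \<and> y \<in> color_points \<beta> \<T> n \<gamma> i})"

text \<open>The set \<open>return_generators\<close> depends neither on the letter (by primitivity) nor on the tile map,
  so it is immaterial which letter \<open>i\<close> is used below.\<close>

definition multiple_strong_coincidence ::
    "'a::finite subst \<Rightarrow> real \<Rightarrow> real^'a \<Rightarrow> 'a tile set \<Rightarrow> nat \<Rightarrow> bool" where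
  "multiple_strong_coincidence \<sigma> \<beta> l \<T> n \<longleftrightarrow>
     (\<forall>\<gamma>. tile_map \<sigma> \<beta> l \<T> n \<gamma> \<and> admissible \<beta> l \<T> n \<gamma> \<and>
        (\<exists>i. {x - y |x y. x \<in> (\<Union>j. color_points \<beta> \<T> n \<gamma> j) \<and> y \<in> (\<Union>j. color_points \<beta> \<T> n \<gamma> j)}
               \<subseteq> group_closure (return_generators \<beta> \<T> n \<gamma> i))
        \<longrightarrow> strong_coincidence \<sigma> \<beta> l \<T> n \<gamma>)"

end

theory Submission
  imports Defs
begin

text \<open>
  The level may depend on \<open>\<T>\<close>, so two implications with different choices of the level suffice:
  overlap coincidence implies multiple strong coincidence of every level, and if overlap coincidence
  fails then some level fails as well. An overlap \<open>(U, y, V)\<close> is described up to translation by its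
  type \<open>(i, j, z)\<close>: the colours of \<open>U\<close> and \<open>V\<close> and the offset \<open>z\<close> from \<open>U\<close> to \<open>V - y\<close>. Inflation
  multiplies the offset by \<open>\<beta>\<close>, and a coincidence after \<open>k\<close> steps is a common tile of the two
  inflated prototiles.

  Assume overlap coincidence, and let \<open>y\<close> be the difference of the control points of two tiles \<open>U\<close> and
  \<open>V\<close>. Admissibility says that \<open>U\<close> and \<open>V - y\<close> overlap, but \<open>y\<close> is merely an element of the group
  generated by contracted return vectors. After inflation it becomes a sum \<open>y\<^sub>1 + \<dots> + y\<^sub>r\<close> of return
  vectors. Adding the summands one at a time, and inflating at each step until overlap coincidence
  produces a coincidence inside the tile found so far, yields a tile that lies in \<open>\<T>\<close> together with
  its translate by the inflated \<open>y\<close> (\<open>overlap_coincidence_common_tile\<close>). If the process starts in the interior of the inflated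
  intersection of \<open>U\<close> and \<open>V - y\<close>, that tile is the desired common tile.

  Assume that overlap coincidence fails. The Pisot property makes the set of overlap types finite
  (\<open>finite_overlap_types\<close>): offsets lie in the lattice spanned by the tile lengths, and each rational
  coordinate of a difference of tile positions is, up to a bounded error, proportional to that
  difference, because the coordinates of \<open>\<beta> ^ k * l $ c\<close> satisfy a linear recurrence whose only
  noncontracting characteristic root is \<open>\<beta>\<close>. Uniqueness of the Perron eigenvector shows that the factor
  does not depend on the letter. By finiteness some type never reaches a coincidence; call it
  bad. All its descendants are bad, and one of them has two different colours
  (\<open>bad_distinct_descendant\<close>), so there is a cycle through a bad type \<open>(a, b, z)\<close> with \<open>a \<noteq> b\<close>. For a
  large multiple \<open>N\<close> of the cycle length, define a tile map that follows the cycle on tiles of the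
  colours \<open>a\<close> and \<open>b\<close> and sends every other tile to an interior tile of colour \<open>a\<close>. Then \<open>z\<close> is the difference of the relative
  control points of \<open>a\<close> and \<open>b\<close>, which makes the control points admissible and puts their differences
  into the required group, while strong coincidence for \<open>a\<close> and \<open>b\<close> would contradict badness
  (\<open>cycle_not_multiple\<close>).
\<close>

unbundle no fps_syntax

section \<open>Linear recurrences with contracting characteristic roots\<close>

definition geometric_decay :: "(nat \<Rightarrow> 'b::real_normed_vector) \<Rightarrow> bool" where
  "geometric_decay w \<longleftrightarrow> (\<exists>C \<rho>. 0 \<le> \<rho> \<and> \<rho> < 1 \<and> (\<forall>k. norm (w k) \<le> C * \<rho> ^ k))"

text \<open>A rate strictly between \<open>max \<rho> (cmod r)\<close> and \<open>1\<close> absorbs both the decay of the inhomogeneity and the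
  factor \<open>r\<close>, even when these two coincide.\<close>

lemma geometric_decay_first_order:
  fixes w :: "nat \<Rightarrow> complex"
  assumes "cmod r < 1" and "geometric_decay (\<lambda>k. w (Suc k) - r * w k)"
  shows "geometric_decay w"
proof -
  obtain C \<rho> where \<rho>: "0 \<le> \<rho>" "\<rho> < 1" and C: "\<And>k. cmod (w (Suc k) - r * w k) \<le> C * \<rho> ^ k"
    using assms(2) unfolding geometric_decay_def by blast
  obtain \<rho>' where \<rho>': "max \<rho> (cmod r) < \<rho>'" "\<rho>' < 1"
    using dense[of "max \<rho> (cmod r)" 1] \<rho> assms(1) by auto
  have C0: "0 \<le> C"
    using order_trans[OF norm_ge_zero C[of 0]] by simp
  define D where "D = max (cmod (w 0)) (C / (\<rho>' - cmod r))"
  have D0: "0 \<le> D" unfolding D_def by (rule max.coboundedI1) simp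
  have pos: "0 < \<rho>' - cmod r" "0 < \<rho>'" using \<rho>' \<rho>(1) by auto
  have "C / (\<rho>' - cmod r) \<le> D" unfolding D_def by simp
  then have CD: "C + cmod r * D \<le> \<rho>' * D"
    using pos by (simp add: field_simps)
  have "cmod (w k) \<le> D * \<rho>' ^ k" for k
  proof (induction k)
    case 0
    then show ?case by (simp add: D_def)
  next
    case (Suc k)
    have "cmod (w (Suc k)) \<le> cmod (w (Suc k) - r * w k) + cmod r * cmod (w k)"
      using norm_triangle_sub[of "w (Suc k)" "r * w k"] by (simp add: norm_mult add.commute)
    also have "\<dots> \<le> C * \<rho> ^ k + cmod r * (D * \<rho>' ^ k)"
      using C Suc by (intro add_mono mult_left_mono) auto
    also have "\<dots> \<le> C * \<rho>' ^ k + cmod r * (D * \<rho>' ^ k)"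
      using \<rho> \<rho>' C0 D0 by (intro add_mono mult_left_mono power_mono) auto
    also have "\<dots> = (C + cmod r * D) * \<rho>' ^ k" by (simp add: algebra_simps)
    also have "\<dots> \<le> (\<rho>' * D) * \<rho>' ^ k" using CD pos by (intro mult_right_mono) auto
    finally show ?case by (simp add: mult_ac)
  qed
  then show ?thesis unfolding geometric_decay_def using pos \<rho>'(2) by (intro exI[of _ D] exI[of _ \<rho>']) auto
qed

text \<open>A factor of the characteristic polynomial splits off as the first-order difference operator
  \<open>u \<mapsto> (\<lambda>k. u (Suc k) - r * u k)\<close>; peeling off one root at a time reduces recurrences to order one.\<close>

lemma recurrence_linear_factor:
  fixes h :: "'b::comm_ring_1 poly"
  shows "(\<Sum>i\<le>Suc (degree h). coeff ([:- r, 1:] * h) i * u (k + i))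
       = (\<Sum>i\<le>degree h. coeff h i * (u (Suc (k + i)) - r * u (k + i)))"
proof -
  have "(\<Sum>i\<le>Suc (degree h). coeff ([:- r, 1:] * h) i * u (k + i))
      = (\<Sum>i\<le>Suc (degree h). coeff (pCons 0 h) i * u (k + i))
        - (\<Sum>i\<le>Suc (degree h). r * coeff h i * u (k + i))"
  proof -
    have "coeff ([:- r, 1:] * h) i = coeff (pCons 0 h) i - r * coeff h i" for i by simp
    then show ?thesis by (simp only: left_diff_distrib sum_subtractf)
  qed
  also have "(\<Sum>i\<le>Suc (degree h). coeff (pCons 0 h) i * u (k + i))
      = (\<Sum>i\<le>degree h. coeff h i * u (Suc (k + i)))"
    by (subst sum.atMost_Suc_shift) simp
  also have "(\<Sum>i\<le>Suc (degree h). r * coeff h i * u (k + i))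
      = (\<Sum>i\<le>degree h. r * coeff h i * u (k + i))"
    by (simp add: coeff_eq_0)
  finally show ?thesis by (simp add: sum_subtractf[symmetric] algebra_simps)
qed

lemma geometric_decay_recurrence:
  fixes h :: "complex poly"
  assumes "h \<noteq> 0" and "\<And>z. poly h z = 0 \<Longrightarrow> cmod z < 1"
    and "geometric_decay (\<lambda>k. \<Sum>i\<le>degree h. coeff h i * w (k + i))"
  shows "geometric_decay w"
  using assms
proof (induction "degree h" arbitrary: h w)
  case 0
  then have c: "coeff h 0 \<noteq> 0" by (metis leading_coeff_0_iff)
  from 0 obtain C \<rho> where \<rho>: "0 \<le> \<rho>" "\<rho> < 1" and C: "\<And>k. cmod (coeff h 0 * w k) \<le> C * \<rho> ^ k"
    unfolding geometric_decay_def by auto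
  have "cmod (w k) \<le> C / cmod (coeff h 0) * \<rho> ^ k" for k
    using C[of k] c by (simp add: norm_mult field_simps)
  then show ?case unfolding geometric_decay_def using \<rho> by blast
next
  case (Suc d)
  obtain r where r: "poly h r = 0"
    using Suc.hyps(2) fundamental_theorem_of_algebra[of h] constant_degree[of h] by auto
  then obtain h' where h': "h = [:- r, 1:] * h'" by (auto simp: poly_eq_0_iff_dvd dvd_def)
  have h'0: "h' \<noteq> 0" using h' Suc.prems(1) by auto
  have deg: "degree h = Suc (degree h')"
    unfolding h' using h'0 by (subst degree_mult_eq) auto
  have eq: "(\<Sum>i\<le>degree h. coeff h i * w (k + i))
      = (\<Sum>i\<le>degree h'. coeff h' i * (w (Suc (k + i)) - r * w (k + i)))" for k
    using recurrence_linear_factor[where h = h' and r = r and u = w and k = k] unfolding deg by (simp add: h')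
  have "geometric_decay (\<lambda>k. w (Suc k) - r * w k)"
  proof (rule Suc.hyps(1)[of h'])
    show "d = degree h'" using Suc.hyps(2) deg by simp
    show "h' \<noteq> 0" by (rule h'0)
    show "cmod z < 1" if "poly h' z = 0" for z
      using Suc.prems(2)[of z] that by (simp add: h')
    show "geometric_decay (\<lambda>k. \<Sum>i\<le>degree h'. coeff h' i * (w (Suc (k + i)) - r * w (k + i)))"
      using Suc.prems(3) unfolding eq .
  qed
  then show ?case
    using Suc.prems(2)[OF r] by (rule geometric_decay_first_order[rotated])
qed

text \<open>For an expanding root the solution of \<open>u (Suc k) - \<beta> * u k = w k\<close> is
  \<open>\<beta> ^ k * (u 0 + (\<Sum>i<k. w i / \<beta> ^ Suc i))\<close>. The full series is the coefficient \<open>A\<close>, and the error is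
  its tail, scaled back by \<open>\<beta> ^ k\<close>.\<close>

lemma geometric_decay_dominant_root:
  fixes u :: "nat \<Rightarrow> real"
  assumes "1 < \<beta>" and "geometric_decay (\<lambda>k. u (Suc k) - \<beta> * u k)"
  obtains A where "geometric_decay (\<lambda>k. u k - A * \<beta> ^ k)"
proof -
  define w where "w k = u (Suc k) - \<beta> * u k" for k
  obtain C \<rho> where \<rho>: "0 \<le> \<rho>" "\<rho> < 1" and C: "\<And>k. \<bar>w k\<bar> \<le> C * \<rho> ^ k"
    using assms(2) unfolding geometric_decay_def w_def by auto
  have C0: "0 \<le> C" using C[of 0] by simp
  have u: "u (k + n) = \<beta> ^ n * (u k + (\<Sum>i<n. w (k + i) / \<beta> ^ Suc i))" for k n
  proof (induction n)
    case (Suc n)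
    have "u (k + Suc n) = w (k + n) + \<beta> * u (k + n)" by (simp add: w_def)
    then show ?case using Suc assms(1) by (simp add: field_simps)
  qed simp
  have bound: "\<bar>w (k + i) / \<beta> ^ Suc i\<bar> \<le> C * \<rho> ^ k * ((1 / \<beta>) ^ Suc i)" for k i
  proof -
    have "\<bar>w (k + i)\<bar> \<le> C * \<rho> ^ k"
      using C[of "k + i"] mult_left_mono[OF power_decreasing[of k "k + i" \<rho>] C0] \<rho> by simp
    then have "\<bar>w (k + i)\<bar> / \<beta> ^ Suc i \<le> C * \<rho> ^ k / \<beta> ^ Suc i"
      using assms(1) by (intro divide_right_mono) auto
    then show ?thesis using assms(1) by (simp add: abs_mult power_divide field_simps)
  qed
  have geo: "(\<lambda>i. (1 / \<beta>) ^ Suc i) sums (1 / (\<beta> - 1))"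
  proof -
    have "(\<lambda>i. (1 / \<beta>) * (1 / \<beta>) ^ i) sums (1 / \<beta> * (1 / (1 - 1 / \<beta>)))"
      using assms(1) by (intro sums_mult geometric_sums) auto
    moreover have "1 / \<beta> * (1 / (1 - 1 / \<beta>)) = 1 / (\<beta> - 1)"
      using assms(1) by (simp add: field_simps)
    ultimately show ?thesis by simp
  qed
  have sm: "summable (\<lambda>i. w (k + i) / \<beta> ^ Suc i)" for k
    by (rule summable_comparison_test'[OF sums_summable[OF sums_mult[OF geo, of "C * \<rho> ^ k"]]])
       (use bound in auto)
  define A where "A = u 0 + (\<Sum>i. w i / \<beta> ^ Suc i)"
  have "\<bar>u k - A * \<beta> ^ k\<bar> \<le> C / (\<beta> - 1) * \<rho> ^ k" for k
  proof -
    have "(\<Sum>i. w i / \<beta> ^ Suc i) = (\<Sum>i. w (i + k) / \<beta> ^ Suc (i + k)) + (\<Sum>i<k. w i / \<beta> ^ Suc i)"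
      using sm[of 0] by (intro suminf_split_initial_segment) simp
    also have "(\<Sum>i. w (i + k) / \<beta> ^ Suc (i + k)) = (\<Sum>i. w (k + i) / \<beta> ^ Suc i / \<beta> ^ k)"
      by (simp add: power_add add.commute mult_ac)
    also have "\<dots> = (\<Sum>i. w (k + i) / \<beta> ^ Suc i) / \<beta> ^ k"
      by (rule suminf_divide[OF sm])
    finally have "A = u k / \<beta> ^ k + (\<Sum>i. w (k + i) / \<beta> ^ Suc i) / \<beta> ^ k"
      using u[of 0 k] assms(1) by (simp add: A_def field_simps)
    then have "u k - A * \<beta> ^ k = - (\<Sum>i. w (k + i) / \<beta> ^ Suc i)"
      using assms(1) by (simp add: field_simps)
    moreover have "\<bar>\<Sum>i. w (k + i) / \<beta> ^ Suc i\<bar> \<le> (\<Sum>i. C * \<rho> ^ k * (1 / \<beta>) ^ Suc i)"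
    proof -
      have s2: "summable (\<lambda>i. C * \<rho> ^ k * (1 / \<beta>) ^ Suc i)"
        by (rule sums_summable[OF sums_mult[OF geo]])
      have s1: "summable (\<lambda>i. \<bar>w (k + i) / \<beta> ^ Suc i\<bar>)"
        by (rule summable_comparison_test'[OF s2]) (use bound in auto)
      have "\<bar>\<Sum>i. w (k + i) / \<beta> ^ Suc i\<bar> \<le> (\<Sum>i. \<bar>w (k + i) / \<beta> ^ Suc i\<bar>)"
        by (rule summable_rabs[OF s1])
      also have "\<dots> \<le> (\<Sum>i. C * \<rho> ^ k * (1 / \<beta>) ^ Suc i)"
        by (rule suminf_le[OF bound s1 s2])
      finally show ?thesis .
    qed
    moreover have "(\<Sum>i. C * \<rho> ^ k * (1 / \<beta>) ^ Suc i) = C / (\<beta> - 1) * \<rho> ^ k"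
      using sums_unique[OF sums_mult[OF geo, of "C * \<rho> ^ k"]] by simp
    ultimately show ?thesis by simp
  qed
  then have "geometric_decay (\<lambda>k. u k - A * \<beta> ^ k)"
    unfolding geometric_decay_def real_norm_def using \<rho> by blast
  then show ?thesis by (rule that)
qed

lemma geometric_decay_tendsto:
  fixes u :: "nat \<Rightarrow> real"
  assumes expanding: "1 < \<beta>" and decay: "geometric_decay (\<lambda>k. u k - A * \<beta> ^ k)"
  shows "(\<lambda>k. u k / \<beta> ^ k) \<longlonglongrightarrow> A"
proof -
  obtain C \<rho> where \<rho>: "0 \<le> \<rho>" "\<rho> < 1" and C: "\<And>k. \<bar>u k - A * \<beta> ^ k\<bar> \<le> C * \<rho> ^ k"
    using decay unfolding geometric_decay_def real_norm_def by blast
  have null: "(\<lambda>k. C * \<rho> ^ k) \<longlonglongrightarrow> 0"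
    using \<rho> by (intro tendsto_mult_right_zero LIMSEQ_power_zero) simp
  have "\<bar>u k / \<beta> ^ k - A\<bar> \<le> C * \<rho> ^ k" for k
  proof -
    have "u k / \<beta> ^ k - A = (u k - A * \<beta> ^ k) / \<beta> ^ k" using expanding by (simp add: field_simps)
    then have "\<bar>u k / \<beta> ^ k - A\<bar> = \<bar>u k - A * \<beta> ^ k\<bar> / \<beta> ^ k" using expanding by (simp add: abs_mult)
    also have "\<dots> \<le> \<bar>u k - A * \<beta> ^ k\<bar>"
      using expanding by (intro divide_le_eq[THEN iffD2]) (auto simp: mult_le_cancel_left1)
    finally show ?thesis using C[of k] by linarith
  qed
  then have "\<forall>\<^sub>F k in sequentially. norm (u k / \<beta> ^ k - A) \<le> C * \<rho> ^ k"
    unfolding real_norm_def by (intro always_eventually allI)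
  then have "(\<lambda>k. u k / \<beta> ^ k - A) \<longlonglongrightarrow> 0"
    by (rule Lim_null_comparison[OF _ null])
  then show ?thesis by (rule LIM_zero_cancel)
qed

section \<open>The minimal polynomial of a Pisot number\<close>

lemma map_poly_of_rat_mult:
  "map_poly of_rat (p * q) = (map_poly of_rat p * map_poly of_rat q :: 'b::field_char_0 poly)"
  by (rule poly_eqI) (simp add: coeff_map_poly coeff_mult of_rat_sum of_rat_mult)

lemma map_poly_of_rat_pderiv:
  "map_poly of_rat (pderiv p) = (pderiv (map_poly of_rat p) :: 'b::field_char_0 poly)"
proof (rule poly_eqI)
  fix n
  have *: "of_rat (rat_of_nat k) = (of_nat k :: 'b)" for k by (rule of_rat_of_nat_eq)
  show "coeff (map_poly of_rat (pderiv p)) n = coeff (pderiv (map_poly of_rat p) :: 'b poly) n"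
    using *[of "Suc n"] by (simp add: coeff_map_poly coeff_pderiv of_rat_mult del: of_nat_Suc)
qed

lemma poly_map_poly_of_real:
  "poly (map_poly complex_of_real p) (complex_of_real x) = complex_of_real (poly p x)"
  by (induction p) (auto simp: map_poly_pCons)

lemma poly_map_poly_of_rat_of_real:
  "poly (map_poly of_rat p) (complex_of_real x) = complex_of_real (poly (map_poly of_rat p) x)"
proof -
  have "complex_of_real (real_of_rat q) = of_rat q" for q
    by (cases q) (simp add: of_rat_rat)
  then have "map_poly complex_of_real (map_poly of_rat p) = map_poly of_rat p"
    by (intro poly_eqI) (simp add: coeff_map_poly)
  then show ?thesis using poly_map_poly_of_real[of "map_poly of_rat p" x] by metis
qed

text \<open>The Pisot property as a statement about recurrences: take a rational polynomial of minimal degree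
  with the root \<open>\<beta>\<close>. It is irreducible, so its roots are the conjugates of \<open>\<beta>\<close>, and \<open>\<beta>\<close> is a simple
  root.\<close>

lemma pisot_annihilator:
  assumes "pisot_number \<beta>"
  obtains p :: "rat poly" and h :: "complex poly" where
    "map_poly of_rat p = [:- complex_of_real \<beta>, 1:] * h" "h \<noteq> 0"
    "\<And>z. poly h z = 0 \<Longrightarrow> cmod z < 1"
proof -
  let ?root = "\<lambda>p :: rat poly. p \<noteq> 0 \<and> poly (map_poly of_rat p) \<beta> = 0"
  have "\<exists>p. ?root p"
  proof -
    have "algebraic \<beta>" using assms algebraic_int_imp_algebraic unfolding pisot_number_def by blast
    then obtain q where q: "\<And>i. coeff q i \<in> \<rat>" "q \<noteq> 0" "poly q \<beta> = 0"
      unfolding algebraic_altdef by blast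
    define p where "p = map_poly (\<lambda>x. THE r. of_rat r = x) q"
    have "(THE r. of_rat r = (0::real)) = 0"
      by (rule the_equality) (auto simp: of_rat_eq_0_iff)
    then have cp: "coeff p i = (THE r. of_rat r = coeff q i)" for i
      unfolding p_def by (simp add: coeff_map_poly)
    have "of_rat (coeff p i) = coeff q i" for i
    proof -
      from q(1)[of i] obtain r where "coeff q i = of_rat r" by (auto elim: Rats_cases)
      moreover have "(THE s. of_rat s = (of_rat r :: real)) = r" by (rule the_equality) auto
      ultimately show ?thesis unfolding cp by simp
    qed
    then have "map_poly of_rat p = q" by (intro poly_eqI) (simp add: coeff_map_poly)
    then show ?thesis using q by (intro exI[of _ p]) auto
  qed
  then obtain p where p: "?root p" and min: "\<And>q. ?root q \<Longrightarrow> degree p \<le> degree q"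
    using ex_has_least_nat[of ?root _ degree] by blast
  have d0: "degree p \<noteq> 0"
  proof
    assume "degree p = 0"
    then obtain c where "p = [:c:]" by (rule degree_eq_zeroE)
    with p show False by (simp add: map_poly_pCons)
  qed
  have irr: "irreducible p"
  proof (rule irreducibleI)
    show "p \<noteq> 0" using p by simp
    show "\<not> is_unit p" using d0 p by (simp add: is_unit_iff_degree)
    fix a b assume ab: "p = a * b"
    with p have nz: "a \<noteq> 0" "b \<noteq> 0" by auto
    have deg: "degree p = degree a + degree b" using ab nz by (simp add: degree_mult_eq)
    have "poly (map_poly of_rat a) \<beta> = 0 \<or> poly (map_poly of_rat b) \<beta> = 0"
      using p by (simp add: ab map_poly_of_rat_mult)
    then have "degree p \<le> degree a \<or> degree p \<le> degree b" using min nz by blast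
    then show "is_unit a \<or> is_unit b" using deg nz by (auto simp: is_unit_iff_degree)
  qed
  let ?P = "map_poly of_rat p :: complex poly"
  have P0: "poly ?P (of_real \<beta>) = 0" using p by (simp add: poly_map_poly_of_rat_of_real)
  then obtain h where h: "?P = [:- complex_of_real \<beta>, 1:] * h"
    by (auto simp: poly_eq_0_iff_dvd dvd_def)
  have "?P \<noteq> 0"
  proof
    assume "?P = 0"
    then have "coeff ?P (degree p) = 0" by simp
    then show False using p by (simp add: coeff_map_poly)
  qed
  then have h0: "h \<noteq> 0" using h by auto
  \<comment> \<open>The derivative of \<open>p\<close> has smaller degree, so minimality makes \<open>\<beta>\<close> a simple root.\<close>
  have simple: "poly h (of_real \<beta>) \<noteq> 0"
  proof
    assume z: "poly h (of_real \<beta>) = 0"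
    have "pderiv ?P = pderiv [:- complex_of_real \<beta>, 1:] * h + [:- complex_of_real \<beta>, 1:] * pderiv h"
      unfolding h by (simp only: pderiv_mult ac_simps)
    then have "poly (pderiv ?P) (of_real \<beta>) = 0" using z by (simp add: pderiv_pCons)
    then have "poly (map_poly of_rat (pderiv p)) (complex_of_real \<beta>) = 0"
      by (simp add: map_poly_of_rat_pderiv)
    then have "poly (map_poly of_rat (pderiv p)) \<beta> = 0"
      unfolding poly_map_poly_of_rat_of_real by simp
    moreover have "pderiv p \<noteq> 0" using d0 by (simp add: pderiv_eq_0_iff)
    ultimately have "degree p \<le> degree (pderiv p)" using min by blast
    then show False using d0 by (simp add: degree_pderiv)
  qed
  show ?thesis
  proof (rule that[OF h h0])
    fix z assume z: "poly h z = 0"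
    then have "poly ?P z = 0" unfolding h by simp
    then have "conjugate_of \<beta> z" unfolding conjugate_of_def using irr p by blast
    moreover have "z \<noteq> of_real \<beta>" using z simple by auto
    ultimately show "cmod z < 1" using assms unfolding pisot_number_def by blast
  qed
qed

section \<open>Rational coordinates\<close>

definition rational_functional :: "(real \<Rightarrow> rat) \<Rightarrow> bool" where
  "rational_functional f \<longleftrightarrow>
     (\<forall>x y. f (x + y) = f x + f y) \<and> (\<forall>q x. f (of_rat q * x) = q * f x)"

lemma rational_functional_add: "rational_functional f \<Longrightarrow> f (x + y) = f x + f y"
  and rational_functional_scale: "rational_functional f \<Longrightarrow> f (of_rat q * x) = q * f x"
  unfolding rational_functional_def by auto

lemma rational_functional_zero: "rational_functional f \<Longrightarrow> f 0 = 0"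
  using rational_functional_add[of f 0 0] by simp

lemma rational_functional_diff: "rational_functional f \<Longrightarrow> f (x - y) = f x - f y"
  using rational_functional_add[of f "x - y" y] by simp

lemma rational_functional_sum:
  "finite I \<Longrightarrow> rational_functional f \<Longrightarrow> f (\<Sum>i\<in>I. g i) = (\<Sum>i\<in>I. f (g i))"
  by (induction I rule: finite_induct)
     (auto simp: rational_functional_add rational_functional_zero)

text \<open>A Hamel basis of \<open>\<real>\<close> over \<open>\<rat>\<close> provides coordinate functionals, and only finitely many of them
  are nonzero somewhere on a given finite set. They reduce finiteness of a set of lattice points to
  boundedness of finitely many rational coordinates with a common denominator.\<close>

lemma separating_rational_functionals:
  fixes S :: "real set"
  assumes "finite S"
  obtains \<Phi> where "finite \<Phi>" "\<And>f. f \<in> \<Phi> \<Longrightarrow> rational_functional f"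
    "\<And>z. z \<in> group_closure S \<Longrightarrow> (\<And>f. f \<in> \<Phi> \<Longrightarrow> f z = 0) \<Longrightarrow> z = 0"
proof -
  interpret Q: vector_space "\<lambda>(q::rat) (x::real). of_rat q * x"
    by standard (auto simp: algebra_simps of_rat_add of_rat_mult)
  define H where "H = Q.extend_basis {}"
  have ind: "Q.independent H" unfolding H_def by (rule Q.independent_extend_basis[OF Q.independent_empty])
  have sp: "Q.span H = UNIV" unfolding H_def by (rule Q.span_extend_basis[OF Q.independent_empty])
  define f where "f b x = Q.representation H x b" for b x
  have rf: "rational_functional (f b)" for b
    unfolding rational_functional_def f_def
    using Q.representation_add[OF ind] Q.representation_scale[OF ind] sp by auto
  define B where "B = (\<Union>s\<in>S. {b. f b s \<noteq> 0})"
  have fB: "finite B" unfolding B_def f_def using assms Q.finite_representation by auto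
  have out: "f b z = 0" if "z \<in> group_closure S" "b \<notin> B" for b z
    using that(1)
  proof induction
    case (base s)
    then show ?case using that(2) rational_functional_zero[OF rf] by (auto simp: B_def)
  next
    case (diff s t)
    then show ?case using rational_functional_diff[OF rf] by simp
  qed
  show ?thesis
  proof (rule that[of "f ` B"])
    fix z assume z: "z \<in> group_closure S" "\<And>g. g \<in> f ` B \<Longrightarrow> g z = 0"
    then have "f b z = 0" for b using out by (cases "b \<in> B") auto
    then have "Q.representation H z b = 0" for b unfolding f_def .
    then show "z = 0"
      using Q.sum_nonzero_representation_eq[OF ind, of z] sp by simp
  qed (use fB rf in auto)
qed

lemma common_denominator:
  fixes A :: "rat set"
  assumes "finite A"
  shows "\<exists>N>0. \<forall>q\<in>A. of_nat N * q \<in> \<int>"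
  using assms
proof (induction A rule: finite_induct)
  case empty
  then show ?case by (intro exI[of _ 1]) simp
next
  case (insert q A)
  then obtain N where N: "0 < N" "\<And>q. q \<in> A \<Longrightarrow> of_nat N * q \<in> \<int>" by blast
  obtain a b where b: "q = Rat.Fract a b" "0 < b" by (cases q) auto
  have d: "of_nat (nat b) * q \<in> \<int>"
    using b by (simp add: Rat.Fract_of_int_quotient)
  have "of_nat (N * nat b) * p \<in> \<int>" if "p \<in> insert q A" for p
  proof (cases "p = q")
    case True
    have "of_nat N * (of_nat (nat b) * q) \<in> \<int>" by (intro Ints_mult d) simp
    then show ?thesis using True by (simp add: mult.assoc)
  next
    case False
    then have "of_nat (nat b) * (of_nat N * p) \<in> \<int>" using that False by (intro Ints_mult[OF Ints_of_nat N(2)]) auto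
    then show ?thesis by (simp add: mult_ac)
  qed
  then show ?case using N(1) b(2) by (intro exI[of _ "N * nat b"]) auto
qed

lemma finite_bounded_rationals:
  assumes "0 < N"
  shows "finite {q::rat. of_nat N * q \<in> \<int> \<and> \<bar>real_of_rat q\<bar> \<le> R}"
proof -
  obtain m where m: "R \<le> real m" using real_arch_simple by blast
  have "{q::rat. of_nat N * q \<in> \<int> \<and> \<bar>real_of_rat q\<bar> \<le> R}
      \<subseteq> (\<lambda>k. k / of_nat N) ` {k \<in> \<int>. \<bar>k\<bar> \<le> of_nat N * of_nat m}"
  proof
    fix q :: rat assume "q \<in> {q. of_nat N * q \<in> \<int> \<and> \<bar>real_of_rat q\<bar> \<le> R}"
    then have q: "of_nat N * q \<in> \<int>" "\<bar>real_of_rat q\<bar> \<le> R" by auto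
    have "real_of_rat \<bar>q\<bar> \<le> real_of_rat (of_nat m)" using q(2) m by simp
    then have "\<bar>q\<bar> \<le> of_nat m" by (simp only: of_rat_less_eq)
    then have "\<bar>of_nat N * q\<bar> \<le> of_nat N * of_nat m" by (simp add: abs_mult mult_left_mono)
    then show "q \<in> (\<lambda>k. k / of_nat N) ` {k \<in> \<int>. \<bar>k\<bar> \<le> of_nat N * of_nat m}"
      using q(1) assms by (intro image_eqI[of _ _ "of_nat N * q"]) auto
  qed
  then show ?thesis by (rule finite_subset) (intro finite_imageI finite_abs_int_segment)
qed


section \<open>Words and patches\<close>

definition subst_word :: "'a subst \<Rightarrow> 'a list \<Rightarrow> 'a list" where
  "subst_word \<sigma> w = concat (map \<sigma> w)"

definition word_length :: "real^'a \<Rightarrow> 'a list \<Rightarrow> real" where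
  "word_length l w = (\<Sum>c\<leftarrow>w. l $ c)"

abbreviation tile :: "real^'a \<Rightarrow> real \<Rightarrow> 'a \<Rightarrow> 'a tile" where
  "tile l x i \<equiv> shift x (proto l i)"

text \<open>The row of tiles that spells the word \<open>w\<close> and starts at the position \<open>x\<close>. Writing the tile substitution
  as an operation on words turns geometry into list manipulation.\<close>

definition patch :: "real^'a \<Rightarrow> real \<Rightarrow> 'a list \<Rightarrow> 'a tile set" where
  "patch l x w = {tile l (x + word_length l u) j |u j v. w = u @ j # v}"

lemma word_length_simps [simp]:
  "word_length l [] = 0" "word_length l (c # w) = l $ c + word_length l w"
  "word_length l (u @ v) = word_length l u + word_length l v"
  by (simp_all add: word_length_def)

lemma subst_word_simps [simp]:
  "subst_word \<sigma> [] = []" "subst_word \<sigma> (c # w) = \<sigma> c @ subst_word \<sigma> w"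
  "subst_word \<sigma> (u @ v) = subst_word \<sigma> u @ subst_word \<sigma> v"
  by (simp_all add: subst_word_def)

lemma iter_append [simp]:
  "(subst_word \<sigma> ^^ k) (u @ v) = (subst_word \<sigma> ^^ k) u @ (subst_word \<sigma> ^^ k) v"
  by (induction k) auto

lemma iter_Nil [simp]: "(subst_word \<sigma> ^^ k) [] = []"
  by (induction k) auto

lemma iter_split:
  "(subst_word \<sigma> ^^ k) (u @ c # v)
     = (subst_word \<sigma> ^^ k) u @ (subst_word \<sigma> ^^ k) [c] @ (subst_word \<sigma> ^^ k) v"
  using iter_append[of k \<sigma> u "[c] @ v"] iter_append[of k \<sigma> "[c]" v] by simp

lemma iter_letter_in:
  assumes "c \<in> set w"
  shows "set ((subst_word \<sigma> ^^ k) [c]) \<subseteq> set ((subst_word \<sigma> ^^ k) w)"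
proof -
  obtain u v where "w = u @ c # v" using assms by (meson split_list)
  then show ?thesis using iter_split[of k \<sigma> u c v] by auto
qed

lemma iter_add_in:
  assumes "c \<in> set ((subst_word \<sigma> ^^ k) [i])" "d \<in> set ((subst_word \<sigma> ^^ m) [c])"
  shows "d \<in> set ((subst_word \<sigma> ^^ (m + k)) [i])"
  using iter_letter_in[OF assms(1), where k = m and \<sigma> = \<sigma>] assms(2) by (auto simp: funpow_add)

lemma shift_shift [simp]: "shift s (shift t T) = shift (s + t) T"
  by (auto simp: shift_def image_iff algebra_simps)

lemma shift_0 [simp]: "shift 0 T = T"
  by (simp add: shift_def)

lemma supp_tile [simp]: "supp (tile l x i) = {x..x + l $ i}"
  by (simp add: shift_def proto_def)

lemma color_shift [simp]: "color (shift x T) = color T"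
  by (simp add: shift_def)

lemma color_proto [simp]: "color (proto l i) = i"
  by (simp add: proto_def)

lemma patch_Nil [simp]: "patch l x [] = {}"
  by (simp add: patch_def)

lemma patch_Cons [simp]: "patch l x (c # w) = insert (tile l x c) (patch l (x + l $ c) w)"
proof (intro equalityI subsetI)
  fix T assume "T \<in> patch l x (c # w)"
  then obtain u j v where u: "c # w = u @ j # v" "T = tile l (x + word_length l u) j"
    unfolding patch_def by blast
  then show "T \<in> insert (tile l x c) (patch l (x + l $ c) w)"
    by (cases u) (auto simp: patch_def add.assoc)
next
  fix T assume "T \<in> insert (tile l x c) (patch l (x + l $ c) w)"
  then consider "T = tile l x c"
    | u j v where "w = u @ j # v" "T = tile l (x + l $ c + word_length l u) j"
    unfolding patch_def by blast
  then show "T \<in> patch l x (c # w)"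
  proof cases
    case 1
    then show ?thesis unfolding patch_def by (auto intro!: exI[of _ "[]"])
  next
    case 2
    then have "c # w = (c # u) @ j # v" "T = tile l (x + word_length l (c # u)) j"
      by (simp_all add: add.assoc)
    then show ?thesis unfolding patch_def by blast
  qed
qed

lemma patch_append [simp]:
  "patch l x (u @ v) = patch l x u \<union> patch l (x + word_length l u) v"
  by (induction u arbitrary: x) (auto simp: algebra_simps)

lemma patch_split: "tile l (x + word_length l u) c \<in> patch l x (u @ c # v)"
  by simp

lemma patch_elim:
  assumes "T \<in> patch l x w"
  obtains u j v where "w = u @ j # v" "T = tile l (x + word_length l u) j"
  using assms unfolding patch_def by blast

lemma shift_patch: "shift t ` patch l x w = patch l (x + t) w"
  by (induction w arbitrary: x) (auto simp: algebra_simps)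

lemma patch_nth:
  "patch l x w = {tile l (x + word_length l (take k w)) (w ! k) |k. k < length w}"
proof -
  have "\<exists>k<length w. tile l (x + word_length l u) j = tile l (x + word_length l (take k w)) (w ! k)"
    if "w = u @ j # v" for u j v
    using that by (intro exI[of _ "length u"]) simp
  moreover have "\<exists>u j v. tile l (x + word_length l (take k w)) (w ! k) = tile l (x + word_length l u) j
      \<and> w = u @ j # v" if "k < length w" for k
    using id_take_nth_drop[OF that] by blast
  ultimately show ?thesis unfolding patch_def by blast
qed

lemma sum_list_scale: "sum_list (map ((*) c) us) = c * sum_list us" for c :: real
  by (induction us) (auto simp: distrib_left)

text \<open>The data of the theorem in terms of words: the eigenvector equation says that substitution
  stretches lengths of words by \<open>\<beta>\<close>, and primitivity that some iterate of each letter contains all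
  letters.\<close>

locale suspension =
  fixes \<sigma> :: "'a::finite subst" and \<beta> :: real and l :: "real^'a" and \<T> :: "'a tile set"
  assumes expanding: "1 < \<beta>"
    and length_pos: "\<And>i. 0 < l $ i"
    and eigen: "\<And>j. word_length l (\<sigma> j) = \<beta> * l $ j"
    and primitive: "\<exists>k. \<forall>i j. i \<in> set ((subst_word \<sigma> ^^ k) [j])"
    and suspension: "suspension_tiling \<sigma> \<beta> l \<T>"
begin

abbreviation iter :: "nat \<Rightarrow> 'a list \<Rightarrow> 'a list" where "iter k \<equiv> subst_word \<sigma> ^^ k"
abbreviation len :: "'a list \<Rightarrow> real" where "len \<equiv> word_length l"
abbreviation til :: "real \<Rightarrow> 'a \<Rightarrow> 'a tile" where "til \<equiv> tile l"
abbreviation pat :: "real \<Rightarrow> 'a list \<Rightarrow> 'a tile set" where "pat \<equiv> patch l"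
abbreviation Omega :: "'a tile set \<Rightarrow> 'a tile set" where "Omega \<equiv> tile_subst \<sigma> \<beta> l"

lemma pow_pos: "0 < \<beta> ^ k" using expanding by simp

lemma len_nonneg: "0 \<le> len w"
  by (induction w) (auto simp: length_pos less_imp_le add_nonneg_nonneg)

lemma len_pos: "w \<noteq> [] \<Longrightarrow> 0 < len w"
  by (cases w) (auto simp: length_pos len_nonneg add_pos_nonneg)

lemma len_subst_word: "len (subst_word \<sigma> w) = \<beta> * len w"
  by (induction w) (auto simp: eigen algebra_simps)

lemma len_iter: "len (iter k w) = \<beta> ^ k * len w"
  by (induction k) (auto simp: len_subst_word)

lemma iter_nonempty: "iter k [i] \<noteq> []"
  using len_iter[of k "[i]"] length_pos[of i] expanding by auto

lemma tile_eq_iff [simp]: "til x i = til x' i' \<longleftrightarrow> x = x' \<and> i = i'"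
proof
  assume a: "til x i = til x' i'"
  from arg_cong[OF a, of color] have "i = i'" by (simp add: proto_def)
  moreover have "{x..x + l $ i} = {x'..x' + l $ i'}" using arg_cong[OF a, of supp] by simp
  ultimately show "x = x' \<and> i = i'" using length_pos[of i] by (simp add: Icc_eq_Icc)
qed simp

lemma subst_tile_tile: "subst_tile \<sigma> \<beta> l (til x i) = pat (\<beta> * x) (\<sigma> i)"
proof -
  have "word_length l (take k w) = (\<Sum>h<k. l $ (w ! h))" if "k < length w" for k w
    using that by (simp add: word_length_def sum_list_sum_nth atLeast0LessThan)
  then have "subst_proto \<sigma> l i = pat 0 (\<sigma> i)"
    unfolding subst_proto_def patch_nth by (intro Collect_cong ex_cong1) auto
  moreover have "subst_tile \<sigma> \<beta> l (til x i) = shift (\<beta> * x) ` subst_proto \<sigma> l i"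
  proof -
    have "subst_tile \<sigma> \<beta> l (til x i) = {shift (\<beta> * x) U |U. U \<in> subst_proto \<sigma> l i}"
      unfolding subst_tile_def color_shift color_proto tile_eq_iff by simp
    then show ?thesis by auto
  qed
  ultimately show ?thesis by (simp add: shift_patch)
qed

lemma tile_subst_patch: "Omega (pat x w) = pat (\<beta> * x) (subst_word \<sigma> w)"
  by (induction w arbitrary: x) (auto simp: tile_subst_def subst_tile_tile eigen algebra_simps)

lemma tile_subst_pow_patch: "(Omega ^^ k) (pat x w) = pat (\<beta> ^ k * x) (iter k w)"
  by (induction k) (auto simp: tile_subst_patch algebra_simps)

lemma tile_subst_pow_tile: "(Omega ^^ k) {til x i} = pat (\<beta> ^ k * x) (iter k [i])"
  using tile_subst_pow_patch[of k x "[i]"] by simp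

lemma patch_covers:
  assumes "w \<noteq> []" "x \<le> t" "t \<le> x + len w"
  obtains s j where "til s j \<in> pat x w" "s \<le> t" "t \<le> s + l $ j"
proof -
  have "\<exists>s j. til s j \<in> pat x w \<and> s \<le> t \<and> t \<le> s + l $ j"
    using assms
  proof (induction w arbitrary: x)
    case (Cons c w)
    show ?case
    proof (cases "t \<le> x + l $ c")
      case True
      then show ?thesis using Cons.prems by (intro exI[of _ x] exI[of _ c]) auto
    next
      case False
      then have "w \<noteq> []" using Cons.prems by auto
      then show ?thesis using Cons.IH[of "x + l $ c"] Cons.prems False by auto
    qed
  qed simp
  then show ?thesis using that by blast
qed

lemma patch_bounds:
  assumes "til s j \<in> pat x w"
  shows "x \<le> s" "s + l $ j \<le> x + len w"
  using assms by (elim patch_elim, simp add: len_nonneg)+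

text \<open>Subdividing one tile of a patch gives a part of the subdivided patch, because the word of the
  inflated patch is a concatenation.\<close>

lemma patch_iter:
  assumes "til s c \<in> pat x w"
  shows "pat (\<beta> ^ m * s) (iter m [c]) \<subseteq> pat (\<beta> ^ m * x) (iter m w)"
proof -
  obtain u v where w: "w = u @ c # v" and s: "s = x + len u"
    using assms by (elim patch_elim) simp
  show ?thesis unfolding w iter_split s by (auto simp: len_iter algebra_simps)
qed

lemma eventually_all_letters: "\<exists>k0. \<forall>k\<ge>k0. \<forall>i j. i \<in> set (iter k [j])"
proof -
  obtain k0 where k0: "\<And>i j. i \<in> set (iter k0 [j])" using primitive by blast
  have "i \<in> set (iter k [j])" if "k0 \<le> k" for k i j
  proof -
    have "i \<in> set (iter (k0 + (k - k0)) [j])"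
      by (rule iter_add_in[OF hd_in_set[OF iter_nonempty] k0])
    then show ?thesis using that by simp
  qed
  then show ?thesis by (intro exI[of _ k0] allI impI)
qed

section \<open>The tiling\<close>

lemma tiling: "tiling l \<T>" and tile_subst_fixed: "Omega \<T> = \<T>"
  using suspension unfolding suspension_tiling_def by simp_all

lemma tiling_tile: "T \<in> \<T> \<Longrightarrow> \<exists>x i. T = til x i"
  by (rule bspec[OF conjunct1[OF tiling[unfolded tiling_def]]])

lemma tiling_disjoint:
  assumes "til x i \<in> \<T>" "til x' i' \<in> \<T>" "x < x' + l $ i'" "x' < x + l $ i"
  shows "x = x' \<and> i = i'"
proof (rule ccontr)
  assume "\<not> ?thesis"
  then have "til x i \<noteq> til x' i'" by simp
  then have "interior (supp (til x i)) \<inter> interior (supp (til x' i')) = {}"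
    by (rule conjunct2[OF conjunct2[OF tiling[unfolded tiling_def]], rule_format, OF assms(1,2)])
  then have "{max x x'<..<min (x + l $ i) (x' + l $ i')} = {}"
    by (simp add: interior_atLeastAtMost_real)
  then show False using assms(3,4) length_pos[of i] length_pos[of i'] by auto
qed

lemma tiling_cover: obtains x i where "til x i \<in> \<T>" "x \<le> t" "t \<le> x + l $ i"
proof -
  have "t \<in> (\<Union>T\<in>\<T>. supp T)" using tiling unfolding tiling_def by simp
  then obtain T where "T \<in> \<T>" "t \<in> supp T" by blast
  with tiling_tile[of T] that show ?thesis by auto
qed

lemma tiling_cover_overlap: obtains s j where "til s j \<in> \<T>" "s < x + l $ i" "x < s + l $ j"
proof -
  obtain s j where "til s j \<in> \<T>" "s \<le> x + l $ i / 2" "x + l $ i / 2 \<le> s + l $ j"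
    using tiling_cover by blast
  then show ?thesis using that[of s j] length_pos[of i] by simp
qed

lemma tile_subst_tiling: "(Omega ^^ k) \<T> = \<T>"
  by (induction k) (auto simp: tile_subst_fixed)

lemma tile_subst_mono: "P \<subseteq> P' \<Longrightarrow> (Omega ^^ k) P \<subseteq> (Omega ^^ k) P'"
  by (induction k) (auto simp: tile_subst_def)

lemma patch_in_tiling: "til x i \<in> \<T> \<Longrightarrow> pat (\<beta> ^ k * x) (iter k [i]) \<subseteq> \<T>"
  using tile_subst_mono[of "{til x i}" \<T> k] by (simp add: tile_subst_pow_tile tile_subst_tiling)

lemma patch_tile_in_tiling:
  assumes "til x i \<in> \<T>" "iter k [i] = u @ c # v"
  shows "til (\<beta> ^ k * x + len u) c \<in> \<T>"
  using patch_in_tiling[OF assms(1), of k] unfolding assms(2) by auto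

text \<open>A tile of \<open>\<T>\<close> that meets the interior of an inflated tile belongs to its subdivision: the
  subdivision consists of tiles of \<open>\<T>\<close> and covers the inflated tile, so one of them meets the given
  tile in an open interval and must be equal to it.\<close>

lemma patch_unique:
  assumes "til x i \<in> \<T>" "til s j \<in> \<T>" "s < \<beta> ^ k * (x + l $ i)" "\<beta> ^ k * x < s + l $ j"
  shows "til s j \<in> pat (\<beta> ^ k * x) (iter k [i])"
proof -
  have L: "len (iter k [i]) = \<beta> ^ k * l $ i" by (simp add: len_iter)
  have "max s (\<beta> ^ k * x) < min (s + l $ j) (\<beta> ^ k * (x + l $ i))"
    using assms(3,4) length_pos[of i] length_pos[of j] pow_pos[of k] by (simp add: algebra_simps)
  then obtain t where t: "max s (\<beta> ^ k * x) < t" "t < min (s + l $ j) (\<beta> ^ k * (x + l $ i))"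
    using dense by blast
  obtain s' j' where s': "til s' j' \<in> pat (\<beta> ^ k * x) (iter k [i])" "s' \<le> t" "t \<le> s' + l $ j'"
    by (rule patch_covers[of "iter k [i]" "\<beta> ^ k * x" t])
       (use t iter_nonempty[of k i] in \<open>auto simp: L algebra_simps\<close>)
  then have "til s' j' \<in> \<T>" using patch_in_tiling[OF assms(1)] by blast
  from tiling_disjoint[OF assms(2) this] have "s = s' \<and> j = j'" using t s' by auto
  with s' show ?thesis by simp
qed

lemma all_colors: "\<exists>x. til x i \<in> \<T>"
proof -
  obtain x c where xc: "til x c \<in> \<T>" using tiling_cover by blast
  obtain k where "i \<in> set (iter k [c])" using primitive by blast
  then obtain u v where "iter k [c] = u @ i # v" by (meson split_list)
  from patch_tile_in_tiling[OF xc this] show ?thesis by blast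
qed

text \<open>Differences of positions in \<open>\<T>\<close> are differences of prefix lengths in iterates of single letters,
  which makes them accessible to induction on the number of iterations.\<close>

lemma tiling_repetitive:
  assumes "til x i \<in> \<T>" "til x' i' \<in> \<T>"
  obtains K c u v u' v' where "iter K [c] = u @ i # v" "iter K [c] = u' @ i' # v'"
    "x - x' = len u - len u'"
proof -
  have "finite {til x i, til x' i'}" "{til x i, til x' i'} \<subseteq> \<T>" using assms by auto
  then obtain K T s where "T \<in> \<T>" and s: "shift s ` {til x i, til x' i'} \<subseteq> (Omega ^^ K) {T}"
    using suspension unfolding suspension_tiling_def by metis
  then obtain t c where T: "T = til t c" using tiling_tile by blast
  have "til (s + x) i \<in> pat (\<beta> ^ K * t) (iter K [c])" "til (s + x') i' \<in> pat (\<beta> ^ K * t) (iter K [c])"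
    using s by (simp_all add: T tile_subst_pow_tile)
  then obtain u v u' v' where "iter K [c] = u @ i # v" "iter K [c] = u' @ i' # v'"
    "s + x = \<beta> ^ K * t + len u" "s + x' = \<beta> ^ K * t + len u'"
    by (elim patch_elim) simp
  then show ?thesis by (intro that[of K c u v u' v']) simp_all
qed

text \<open>A tile that covers a point slightly to the right of \<open>x + l $ i\<close>, closer than the shortest tile
  length, has to start at \<open>x + l $ i\<close>, as a gap in front of it could not be filled.\<close>

lemma right_neighbour:
  assumes "til x i \<in> \<T>"
  obtains j where "til (x + l $ i) j \<in> \<T>"
proof -
  define m where "m = Min (range (($) l))"
  have m: "0 < m" "\<And>j. m \<le> l $ j" unfolding m_def using length_pos by (auto simp: Min_gr_iff)
  obtain s j where s: "til s j \<in> \<T>" "s \<le> x + l $ i + m / 2" "x + l $ i + m / 2 \<le> s + l $ j"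
    using tiling_cover by blast
  have ge: "x + l $ i \<le> s"
  proof (rule ccontr)
    assume "\<not> ?thesis"
    then have "x = s \<and> i = j" using tiling_disjoint[OF assms s(1)] s m(1) length_pos[of i] by auto
    then show False using s(3) m by auto
  qed
  have "s = x + l $ i"
  proof (rule ccontr)
    assume "s \<noteq> x + l $ i"
    with ge have lt: "x + l $ i < s" by simp
    define t where "t = (x + l $ i + s) / 2"
    obtain r c where r: "til r c \<in> \<T>" "r \<le> t" "t \<le> r + l $ c" using tiling_cover by blast
    have "r \<ge> x + l $ i"
      using tiling_disjoint[OF assms r(1)] r lt length_pos[of i] unfolding t_def by force
    moreover have "r + l $ c \<le> s"
      using tiling_disjoint[OF s(1) r(1)] r lt length_pos[of j] unfolding t_def by force
    ultimately show False using s(2) m(2)[of c] m(1) by linarith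
  qed
  with s that show ?thesis by blast
qed

end

section \<open>Overlaps as offsets\<close>

context suspension
begin

abbreviation Xi :: "real set" where "Xi \<equiv> return_vectors \<T>"

text \<open>Offsets are measured from the left end of a tile of colour \<open>i\<close> to the left end of one of colour \<open>j\<close>.\<close>

definition agree :: "nat \<Rightarrow> 'a \<Rightarrow> 'a \<Rightarrow> real \<Rightarrow> bool" where
  "agree k i j z \<longleftrightarrow> pat 0 (iter k [i]) \<inter> pat (\<beta> ^ k * z) (iter k [j]) \<noteq> {}"

definition overlapping :: "'a \<Rightarrow> 'a \<Rightarrow> real \<Rightarrow> bool" where
  "overlapping i j z \<longleftrightarrow> z < l $ i \<and> - z < l $ j"

definition overlap_types :: "('a \<times> 'a \<times> real) set" where
  "overlap_types = {(i, j, z). overlapping i j z \<and>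
     (\<exists>x. \<exists>y\<in>Xi. til x i \<in> \<T> \<and> til (x + z + y) j \<in> \<T>)}"

lemma patch_tile: "T \<in> pat x w \<Longrightarrow> \<exists>s c. T = til s c"
  by (elim patch_elim) blast

lemma patch_shift_iff: "til (s + t) c \<in> pat (x + t) w \<longleftrightarrow> til s c \<in> pat x w"
proof -
  have "til (s + t) c = shift t (til s c)" by (simp add: add.commute)
  moreover have "inj (shift t :: 'a tile \<Rightarrow> 'a tile)"
    by (rule inj_on_inverseI[of _ "shift (- t)"]) simp
  ultimately show ?thesis by (metis inj_image_mem_iff shift_patch)
qed

text \<open>Since the tile substitution commutes with translations, agreement may be tested with the first
  tile at any position \<open>x\<close>.\<close>

lemma agree_iff:
  "agree k i j z \<longleftrightarrow>
     (\<exists>s c. til s c \<in> pat (\<beta> ^ k * x) (iter k [i]) \<and> til s c \<in> pat (\<beta> ^ k * (x + z)) (iter k [j]))"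
proof
  assume "agree k i j z"
  then obtain T where T: "T \<in> pat 0 (iter k [i])" "T \<in> pat (\<beta> ^ k * z) (iter k [j])"
    unfolding agree_def by blast
  then obtain s c where "T = til s c" using patch_tile by blast
  then have "til (s + \<beta> ^ k * x) c \<in> pat (\<beta> ^ k * x) (iter k [i])"
    "til (s + \<beta> ^ k * x) c \<in> pat (\<beta> ^ k * (x + z)) (iter k [j])"
    using T patch_shift_iff[of s "\<beta> ^ k * x" c] by (metis add_0, metis add.commute distrib_left)
  then show "\<exists>s c. til s c \<in> pat (\<beta> ^ k * x) (iter k [i]) \<and> til s c \<in> pat (\<beta> ^ k * (x + z)) (iter k [j])"
    by blast
next
  assume "\<exists>s c. til s c \<in> pat (\<beta> ^ k * x) (iter k [i]) \<and> til s c \<in> pat (\<beta> ^ k * (x + z)) (iter k [j])"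
  then obtain s c where s: "til s c \<in> pat (\<beta> ^ k * x) (iter k [i])"
    "til s c \<in> pat (\<beta> ^ k * (x + z)) (iter k [j])" by blast
  have "til (s - \<beta> ^ k * x) c \<in> pat 0 (iter k [i])"
    using s(1) patch_shift_iff[of s "- (\<beta> ^ k * x)" c "\<beta> ^ k * x"] by simp
  moreover have "til (s - \<beta> ^ k * x) c \<in> pat (\<beta> ^ k * z) (iter k [j])"
    using s(2) patch_shift_iff[of s "- (\<beta> ^ k * x)" c "\<beta> ^ k * (x + z)"] by (simp add: distrib_left)
  ultimately show "agree k i j z" unfolding agree_def by blast
qed

text \<open>A common tile of a pair of descendants is a common tile of the original pair at a later stage.\<close>

lemma agree_descend:
  assumes "til s c \<in> pat 0 (iter k [i])" "til t d \<in> pat (\<beta> ^ k * z) (iter k [j])"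
    "agree m c d (t - s)"
  shows "agree (m + k) i j z"
proof -
  obtain r e where r: "til r e \<in> pat (\<beta> ^ m * s) (iter m [c])" "til r e \<in> pat (\<beta> ^ m * t) (iter m [d])"
    using assms(3) agree_iff[of m c d "t - s" s] by auto
  have "til r e \<in> pat 0 (iter (m + k) [i])"
    using patch_iter[OF assms(1), of m] r(1) by (auto simp: funpow_add)
  moreover have "til r e \<in> pat (\<beta> ^ (m + k) * z) (iter (m + k) [j])"
    using patch_iter[OF assms(2), of m] r(2) by (auto simp: funpow_add power_add mult.assoc)
  ultimately show ?thesis unfolding agree_def by blast
qed

lemma agree_refl: "agree m c c 0"
proof -
  obtain w v where "iter m [c] = w # v" using iter_nonempty by (metis neq_Nil_conv)
  then show ?thesis unfolding agree_def by simp
qed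

lemma agree_mono:
  assumes "agree k i j z" "k \<le> k'"
  shows "agree k' i j z"
proof -
  obtain s c where "til s c \<in> pat 0 (iter k [i])" "til s c \<in> pat (\<beta> ^ k * z) (iter k [j])"
    using assms(1) agree_iff[of k i j z 0] by auto
  from agree_descend[OF this, of "k' - k"] agree_refl assms(2) show ?thesis by simp
qed

lemma return_vectors_iff: "y \<in> Xi \<longleftrightarrow> (\<exists>x i. til x i \<in> \<T> \<and> til (x + y) i \<in> \<T>)"
proof
  assume "y \<in> Xi"
  then obtain V where V: "V \<in> \<T>" "shift (- y) V \<in> \<T>" unfolding return_vectors_def by blast
  moreover obtain t i where t: "V = til t i" using tiling_tile[OF V(1)] by blast
  ultimately have "til (t - y) i \<in> \<T> \<and> til (t - y + y) i \<in> \<T>" by simp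
  then show "\<exists>x i. til x i \<in> \<T> \<and> til (x + y) i \<in> \<T>" by blast
next
  assume "\<exists>x i. til x i \<in> \<T> \<and> til (x + y) i \<in> \<T>"
  then obtain x i where "til x i \<in> \<T>" "til (x + y) i \<in> \<T>" by blast
  moreover have "til x i = shift (- y) (til (x + y) i)" by simp
  ultimately show "y \<in> Xi" unfolding return_vectors_def by blast
qed

lemma return_vectors_scale:
  assumes "y \<in> Xi"
  shows "\<beta> ^ k * y \<in> Xi"
proof -
  obtain x i where x: "til x i \<in> \<T>" "til (x + y) i \<in> \<T>" using assms return_vectors_iff by blast
  obtain c v where v: "iter k [i] = [] @ c # v" using iter_nonempty[of k i] by (cases "iter k [i]") auto
  have "til (\<beta> ^ k * x) c \<in> \<T>" "til (\<beta> ^ k * x + \<beta> ^ k * y) c \<in> \<T>"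
    using patch_tile_in_tiling[OF x(1) v] patch_tile_in_tiling[OF x(2) v] by (simp_all add: distrib_left)
  then show ?thesis using return_vectors_iff by blast
qed

lemma return_vectors_minus: "y \<in> Xi \<Longrightarrow> - y \<in> Xi"
  unfolding return_vectors_iff by (metis add.right_inverse add.assoc add_0_right)

lemma interior_overlap:
  "interior {x..x + l $ i} \<inter> interior {x'..x' + l $ j} \<noteq> {} \<longleftrightarrow> overlapping i j (x' - x)"
  using length_pos[of i] length_pos[of j]
  by (auto simp: interior_atLeastAtMost_real overlapping_def)

lemma overlaps_iff:
  "(til x i, y, til x' j) \<in> overlaps \<T> \<longleftrightarrow>
     til x i \<in> \<T> \<and> til x' j \<in> \<T> \<and> y \<in> Xi \<and> overlapping i j (x' - y - x)"
  using interior_overlap[of x i "x' - y" j] unfolding overlaps_def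
  by (simp add: algebra_simps)

text \<open>The requirement that the resulting triple be an overlap of \<open>\<T>\<close> is automatic for a coincidence,
  since return vectors are preserved by inflation.\<close>

lemma coincidence_iff_agree:
  assumes "til x i \<in> \<T>" "til x' j \<in> \<T>" "y \<in> Xi"
  shows "(\<exists>ov\<in>subst_overlap \<sigma> \<beta> l \<T> k (til x i, y, til x' j). coincidence ov)
           \<longleftrightarrow> agree k i j (x' - y - x)"
proof
  assume "\<exists>ov\<in>subst_overlap \<sigma> \<beta> l \<T> k (til x i, y, til x' j). coincidence ov"
  then obtain U V where U: "U \<in> pat (\<beta> ^ k * x) (iter k [i])" and V: "V \<in> pat (\<beta> ^ k * x') (iter k [j])"
    and eq: "U = shift (- (\<beta> ^ k * y)) V"
    by (auto simp: tile_subst_pow_tile)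
  obtain s c where s: "V = til s c" using patch_tile[OF V] by blast
  have "til (s - \<beta> ^ k * y) c \<in> pat (\<beta> ^ k * (x' - y)) (iter k [j])"
    using V patch_shift_iff[of s "- (\<beta> ^ k * y)" c "\<beta> ^ k * x'"] by (simp add: s right_diff_distrib)
  moreover have "til (s - \<beta> ^ k * y) c \<in> pat (\<beta> ^ k * x) (iter k [i])"
    using U by (simp add: eq s)
  ultimately show "agree k i j (x' - y - x)" using agree_iff[of k i j "x' - y - x" x] by auto
next
  assume "agree k i j (x' - y - x)"
  then obtain s c where s: "til s c \<in> pat (\<beta> ^ k * x) (iter k [i])"
    "til s c \<in> pat (\<beta> ^ k * (x' - y)) (iter k [j])"
    using agree_iff[of k i j "x' - y - x" x] by auto
  have s': "til (s + \<beta> ^ k * y) c \<in> pat (\<beta> ^ k * x') (iter k [j])"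
    using s(2) patch_shift_iff[of s "\<beta> ^ k * y" c "\<beta> ^ k * (x' - y)"] by (simp add: right_diff_distrib)
  have "til s c \<in> \<T>" "til (s + \<beta> ^ k * y) c \<in> \<T>"
    using patch_in_tiling assms s(1) s' by blast+
  then have ov: "(til s c, \<beta> ^ k * y, til (s + \<beta> ^ k * y) c) \<in> overlaps \<T>"
    using return_vectors_scale[OF assms(3)] length_pos[of c] by (simp add: overlaps_iff overlapping_def)
  have "(til s c, \<beta> ^ k * y, til (s + \<beta> ^ k * y) c) \<in> subst_overlap \<sigma> \<beta> l \<T> k (til x i, y, til x' j)"
    unfolding subst_overlap.simps tile_subst_pow_tile using s(1) s' ov by blast
  moreover have "coincidence (til s c, \<beta> ^ k * y, til (s + \<beta> ^ k * y) c)" by simp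
  ultimately show "\<exists>ov\<in>subst_overlap \<sigma> \<beta> l \<T> k (til x i, y, til x' j). coincidence ov"
    by blast
qed

lemma overlap_coincidence_iff:
  "overlap_coincidence \<sigma> \<beta> l \<T> \<longleftrightarrow> (\<exists>k\<ge>1. \<forall>(i, j, z)\<in>overlap_types. agree k i j z)"
proof -
  have "(\<forall>ov\<in>overlaps \<T>. \<exists>ov'\<in>subst_overlap \<sigma> \<beta> l \<T> k ov. coincidence ov')
      \<longleftrightarrow> (\<forall>(i, j, z)\<in>overlap_types. agree k i j z)" for k
  proof (intro iffI ballI, safe)
    fix i j z assume a: "\<forall>ov\<in>overlaps \<T>. \<exists>ov'\<in>subst_overlap \<sigma> \<beta> l \<T> k ov. coincidence ov'"
      and "(i, j, z) \<in> overlap_types"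
    then obtain x y where xy: "til x i \<in> \<T>" "til (x + z + y) j \<in> \<T>" "y \<in> Xi" "overlapping i j z"
      unfolding overlap_types_def by blast
    then have "(til x i, y, til (x + z + y) j) \<in> overlaps \<T>" by (simp add: overlaps_iff)
    from bspec[OF a this] show "agree k i j z"
      unfolding coincidence_iff_agree[OF xy(1-3)] by simp
  next
    fix S c y S' d
    assume a: "\<forall>(i, j, z)\<in>overlap_types. agree k i j z" and ov: "((S, c), y, S', d) \<in> overlaps \<T>"
    then have "(S, c) \<in> \<T>" "(S', d) \<in> \<T>" unfolding overlaps_def by auto
    then obtain x i x' j where eq: "(S, c) = til x i" "(S', d) = til x' j" using tiling_tile by metis
    have x: "til x i \<in> \<T>" "til x' j \<in> \<T>" "y \<in> Xi" "overlapping i j (x' - y - x)"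
      using ov unfolding eq overlaps_iff by auto
    then have "(i, j, x' - y - x) \<in> overlap_types" unfolding overlap_types_def
      by (auto intro!: exI[of _ x] bexI[of _ y])
    then have "agree k i j (x' - y - x)" using a by blast
    then show "\<exists>ov'\<in>subst_overlap \<sigma> \<beta> l \<T> k ((S, c), y, S', d). coincidence ov'"
      unfolding eq coincidence_iff_agree[OF x(1-3)] .
  qed
  then show ?thesis unfolding overlap_coincidence_def by simp
qed

section \<open>Coincidence along sums of return vectors\<close>

text \<open>Given a tile that lies in \<open>\<T>\<close> together with its translate by \<open>\<beta> ^ k * sum_list ys\<close>, the translate
  overlaps some tile of \<open>\<T>\<close> shifted back by the return vector \<open>\<beta> ^ k * y\<close>. Overlap coincidence then
  gives a smaller tile that survives the translation by the longer sum. Every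
  step stays inside the tile found before.\<close>

lemma overlap_coincidence_common_tile:
  assumes oc: "\<And>i j z. (i, j, z) \<in> overlap_types \<Longrightarrow> agree k0 i j z"
    and "set ys \<subseteq> Xi" and x: "til x i \<in> \<T>"
  shows "\<exists>k s c. til s c \<in> pat (\<beta> ^ k * x) (iter k [i]) \<and> til (s + \<beta> ^ k * sum_list ys) c \<in> \<T>"
  using assms(2)
proof (induction ys)
  case Nil
  show ?case using x by (intro exI[of _ 0] exI[of _ x] exI[of _ i]) simp
next
  case (Cons y ys)
  then obtain k s c where s: "til s c \<in> pat (\<beta> ^ k * x) (iter k [i])"
    "til (s + \<beta> ^ k * sum_list ys) c \<in> \<T>" by auto
  define a where "a = s + \<beta> ^ k * sum_list ys"
  have y: "\<beta> ^ k * y \<in> Xi" using Cons.prems return_vectors_scale by simp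
  obtain r d where r: "til r d \<in> \<T>" "r < a + \<beta> ^ k * y + l $ c" "a + \<beta> ^ k * y < r + l $ d"
    using tiling_cover_overlap by blast
  define z where "z = r - \<beta> ^ k * y - a"
  have "overlapping c d z" using r(2,3) by (simp add: overlapping_def z_def)
  then have "(c, d, z) \<in> overlap_types"
    unfolding overlap_types_def using s(2) r(1) y
    by (auto intro!: exI[of _ a] bexI[of _ "\<beta> ^ k * y"] simp: a_def[symmetric] z_def)
  from oc[OF this] obtain t e where t: "til t e \<in> pat (\<beta> ^ k0 * a) (iter k0 [c])"
    "til t e \<in> pat (\<beta> ^ k0 * (a + z)) (iter k0 [d])"
    using agree_iff[of k0 c d z a] by auto
  define t' where "t' = t - \<beta> ^ (k0 + k) * sum_list ys"
  have "til t' e \<in> pat (\<beta> ^ k0 * s) (iter k0 [c])"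
    using t(1) patch_shift_iff[of t "- (\<beta> ^ (k0 + k) * sum_list ys)" e "\<beta> ^ k0 * a"]
    by (simp add: a_def t'_def power_add algebra_simps)
  then have "til t' e \<in> pat (\<beta> ^ (k0 + k) * x) (iter (k0 + k) [i])"
    using patch_iter[OF s(1), of k0] by (auto simp: funpow_add power_add mult.assoc)
  moreover have "til (t' + \<beta> ^ (k0 + k) * sum_list (y # ys)) e \<in> \<T>"
  proof -
    have "til (t + \<beta> ^ (k0 + k) * y) e \<in> pat (\<beta> ^ k0 * r) (iter k0 [d])"
      using t(2) patch_shift_iff[of t "\<beta> ^ (k0 + k) * y" e "\<beta> ^ k0 * (a + z)"]
      by (simp add: z_def power_add algebra_simps)
    then show ?thesis using patch_in_tiling[OF r(1)] by (auto simp: t'_def algebra_simps)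
  qed
  ultimately show ?case by blast
qed

definition max_length :: real where "max_length = Max (range (($) l))"

lemma max_length: "l $ i \<le> max_length" "0 < max_length"
proof -
  show *: "l $ i \<le> max_length" for i unfolding max_length_def by simp
  show "0 < max_length" using *[of undefined] length_pos[of undefined] by simp
qed

lemma inflated_interval_contains_tile:
  assumes "a < b" "x \<le> a" "b \<le> x + l $ i"
  shows "\<exists>k0. \<forall>k\<ge>k0.
    \<exists>s c. til s c \<in> pat (\<beta> ^ k * x) (iter k [i]) \<and> \<beta> ^ k * a < s \<and> s + l $ c < \<beta> ^ k * b"
proof -
  define t where "t = (a + b) / 2"
  define e where "e = (b - a) / 2"
  have e: "0 < e" "a = t - e" "b = t + e" using assms(1) by (simp_all add: t_def e_def field_simps)
  obtain k0 where k0: "max_length / e < \<beta> ^ k0" using real_arch_pow[OF expanding] by blast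
  show ?thesis
  proof (intro exI[of _ k0] allI impI)
    fix k assume "k0 \<le> k"
    then have "\<beta> ^ k0 \<le> \<beta> ^ k" using expanding by (intro power_increasing) auto
    then have "max_length / e < \<beta> ^ k" using k0 by linarith
    then have big: "max_length < \<beta> ^ k * e" using e(1) by (simp add: field_simps)
    have "\<beta> ^ k * x \<le> \<beta> ^ k * t" "\<beta> ^ k * t \<le> \<beta> ^ k * x + \<beta> ^ k * l $ i"
      using assms e pow_pos[of k] by (simp_all flip: distrib_left)
    then obtain s c where s: "til s c \<in> pat (\<beta> ^ k * x) (iter k [i])" "s \<le> \<beta> ^ k * t" "\<beta> ^ k * t \<le> s + l $ c"
      using patch_covers[of "iter k [i]" "\<beta> ^ k * x" "\<beta> ^ k * t"] iter_nonempty[of k i]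
      by (auto simp: len_iter)
    show "\<exists>s c. til s c \<in> pat (\<beta> ^ k * x) (iter k [i]) \<and> \<beta> ^ k * a < s \<and> s + l $ c < \<beta> ^ k * b"
      by (intro exI[of _ s] exI[of _ c])
         (use s big max_length(1)[of c] in \<open>auto simp: e(2,3) algebra_simps\<close>)
  qed
qed

text \<open>Start the construction of a common tile strictly inside the inflated overlap of the two tiles. The
  tile found there and its translate then belong to the subdivisions of the two given tiles, by
  \<open>patch_unique\<close>.\<close>

lemma overlap_coincidence_agree:
  assumes oc: "overlap_coincidence \<sigma> \<beta> l \<T>"
    and x: "til x i \<in> \<T>" and x': "til x' j \<in> \<T>" and ov: "overlapping i j (x' - y - x)"
    and ys: "set ys \<subseteq> Xi" "\<beta> ^ K * y = sum_list ys"
  shows "\<exists>L\<ge>1. agree L i j (x' - y - x)"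
proof -
  obtain k1 where k1: "\<And>i j z. (i, j, z) \<in> overlap_types \<Longrightarrow> agree k1 i j z"
    using oc unfolding overlap_coincidence_iff by blast
  define a b where "a = max x (x' - y)" and "b = min (x + l $ i) (x' - y + l $ j)"
  have "a < b" "x \<le> a" "b \<le> x + l $ i"
    using ov length_pos[of i] length_pos[of j] by (auto simp: a_def b_def overlapping_def)
  then obtain k0 where k0: "\<And>k. k0 \<le> k \<Longrightarrow>
      \<exists>s c. til s c \<in> pat (\<beta> ^ k * x) (iter k [i]) \<and> \<beta> ^ k * a < s \<and> s + l $ c < \<beta> ^ k * b"
    using inflated_interval_contains_tile by meson
  define k where "k = k0 + K"
  obtain s c where s: "til s c \<in> pat (\<beta> ^ k * x) (iter k [i])" "\<beta> ^ k * a < s" "s + l $ c < \<beta> ^ k * b"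
    using k0[of k] by (auto simp: k_def)
  have "til s c \<in> \<T>" using s(1) patch_in_tiling[OF x] by blast
  define zs where "zs = map ((*) (\<beta> ^ k0)) ys"
  have "set zs \<subseteq> Xi" using ys(1) return_vectors_scale by (auto simp: zs_def)
  moreover have zs: "sum_list zs = \<beta> ^ k * y"
    using ys(2) by (simp add: zs_def sum_list_scale k_def power_add mult.assoc)
  ultimately obtain m r d where r: "til r d \<in> pat (\<beta> ^ m * s) (iter m [c])"
    "til (r + \<beta> ^ m * (\<beta> ^ k * y)) d \<in> \<T>"
    using overlap_coincidence_common_tile[OF k1 _ \<open>til s c \<in> \<T>\<close>, of zs] by auto
  have bounds: "\<beta> ^ m * s \<le> r" "r + l $ d \<le> \<beta> ^ m * (s + l $ c)"
    using patch_bounds[OF r(1)] by (simp_all add: len_iter distrib_left)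
  have le: "x' - y \<le> a" "b \<le> x' - y + l $ j" by (simp_all add: a_def b_def)
  have "\<beta> ^ (m + k) * (x' - y) < r + l $ d"
  proof -
    have "\<beta> ^ k * (x' - y) \<le> \<beta> ^ k * a" using le(1) pow_pos[of k] by simp
    then have "\<beta> ^ k * (x' - y) \<le> s" using s(2) by linarith
    then have "\<beta> ^ m * (\<beta> ^ k * (x' - y)) \<le> \<beta> ^ m * s" using pow_pos[of m] by simp
    then show ?thesis using bounds(1) length_pos[of d] by (simp add: power_add mult.assoc)
  qed
  moreover have "r < \<beta> ^ (m + k) * (x' - y + l $ j)"
  proof -
    have "\<beta> ^ k * b \<le> \<beta> ^ k * (x' - y + l $ j)" using le(2) pow_pos[of k] by simp
    then have "s + l $ c \<le> \<beta> ^ k * (x' - y + l $ j)" using s(3) by linarith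
    then have "\<beta> ^ m * (s + l $ c) \<le> \<beta> ^ m * (\<beta> ^ k * (x' - y + l $ j))" using pow_pos[of m] by simp
    then show ?thesis using bounds(2) length_pos[of d] by (simp add: power_add mult.assoc)
  qed
  ultimately have "til (r + \<beta> ^ (m + k) * y) d \<in> pat (\<beta> ^ (m + k) * x') (iter (m + k) [j])"
    using r(2) by (intro patch_unique[OF x']) (simp_all add: power_add algebra_simps)
  then have "til r d \<in> pat (\<beta> ^ (m + k) * (x' - y)) (iter (m + k) [j])"
    using patch_shift_iff[of r "\<beta> ^ (m + k) * y" d "\<beta> ^ (m + k) * (x' - y)"]
    by (simp add: right_diff_distrib)
  moreover have "til r d \<in> pat (\<beta> ^ (m + k) * x) (iter (m + k) [i])"
    using patch_iter[OF s(1), of m] r(1) by (auto simp: funpow_add power_add mult.assoc)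
  ultimately have "agree (m + k) i j (x' - y - x)"
    using agree_iff[of "m + k" i j "x' - y - x" x] by auto
  then have "agree (Suc (m + k)) i j (x' - y - x)" by (rule agree_mono) simp
  then show ?thesis by (intro exI[of _ "Suc (m + k)"]) simp
qed

end

section \<open>Control points\<close>

locale tile_mapped = suspension +
  fixes n :: nat and \<gamma> :: "'a tile \<Rightarrow> 'a tile"
  assumes tile_map: "tile_map \<sigma> \<beta> l \<T> n \<gamma>" and n_pos: "1 \<le> n"
begin

abbreviation cp :: "'a tile \<Rightarrow> real" where "cp \<equiv> tiling_control_point \<beta> n \<gamma>"

text \<open>The condition for \<open>k = 0\<close> is implied by those for \<open>k \<ge> 1\<close>, because each tile selected by \<open>\<gamma>\<close> lies in the
  inflation of the previous one. Including it makes the condition compatible with applying \<open>\<gamma>\<close>.\<close>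

definition is_cp :: "real \<Rightarrow> 'a tile \<Rightarrow> bool" where
  "is_cp p T \<longleftrightarrow> (\<forall>k. p * \<beta> ^ (n * k) \<in> supp ((\<gamma> ^^ k) T))"

lemma map_in_tiling: "T \<in> \<T> \<Longrightarrow> \<gamma> T \<in> \<T>"
  and map_in_subst: "T \<in> \<T> \<Longrightarrow> \<gamma> T \<in> (Omega ^^ n) {T}"
  and map_shift: "T \<in> \<T> \<Longrightarrow> shift x T \<in> \<T> \<Longrightarrow> \<gamma> (shift x T) = shift (\<beta> ^ n * x) (\<gamma> T)"
  using tile_map unfolding tile_map_def by blast+

lemma map_pow_in_tiling: "T \<in> \<T> \<Longrightarrow> (\<gamma> ^^ k) T \<in> \<T>"
  by (induction k) (auto simp: map_in_tiling)

lemma map_pow_shift: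
  assumes "T \<in> \<T>" "shift x T \<in> \<T>"
  shows "(\<gamma> ^^ k) (shift x T) = shift (\<beta> ^ (n * k) * x) ((\<gamma> ^^ k) T)"
proof (induction k)
  case (Suc k)
  have "shift (\<beta> ^ (n * k) * x) ((\<gamma> ^^ k) T) \<in> \<T>"
    using map_pow_in_tiling[OF assms(2), of k] Suc by simp
  from map_shift[OF map_pow_in_tiling[OF assms(1)] this] Suc
  show ?case by (simp add: power_add mult.assoc)
qed simp

lemma map_supp:
  assumes "T \<in> \<T>" "t * \<beta> ^ n \<in> supp (\<gamma> T)"
  shows "t \<in> supp T"
proof -
  obtain x i where x: "T = til x i" using tiling_tile[OF assms(1)] by blast
  obtain s c where s: "\<gamma> T = til s c" using tiling_tile[OF map_in_tiling[OF assms(1)]] by blast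
  have "til s c \<in> pat (\<beta> ^ n * x) (iter n [i])"
    using map_in_subst[OF assms(1)] unfolding s[symmetric] by (simp add: x tile_subst_pow_tile)
  from patch_bounds[OF this] have "\<beta> ^ n * x \<le> s" "s + l $ c \<le> \<beta> ^ n * (x + l $ i)"
    by (simp_all add: len_iter distrib_left)
  then have "\<beta> ^ n * x \<le> \<beta> ^ n * t" "\<beta> ^ n * t \<le> \<beta> ^ n * (x + l $ i)"
    using assms(2) by (auto simp: s mult.commute)
  then show ?thesis using pow_pos[of n] by (simp add: x)
qed

lemma is_cp_alt:
  assumes "T \<in> \<T>"
  shows "p \<in> (\<Inter>k\<in>{1..}. (\<lambda>t. t / \<beta> ^ (n * k)) ` supp ((\<gamma> ^^ k) T)) \<longleftrightarrow> is_cp p T"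
proof -
  have 1: "p \<in> (\<lambda>t. t / \<beta> ^ (n * k)) ` supp ((\<gamma> ^^ k) T) \<longleftrightarrow> p * \<beta> ^ (n * k) \<in> supp ((\<gamma> ^^ k) T)" for k
    using expanding by (auto simp: image_iff intro!: bexI[of _ "p * \<beta> ^ (n * k)"])
  have "p * \<beta> ^ (n * 0) \<in> supp ((\<gamma> ^^ 0) T)" if "p * \<beta> ^ (n * 1) \<in> supp ((\<gamma> ^^ 1) T)"
    using map_supp[OF assms] that by simp
  then have "is_cp p T \<longleftrightarrow> (\<forall>k\<in>{1..}. p * \<beta> ^ (n * k) \<in> supp ((\<gamma> ^^ k) T))"
    unfolding is_cp_def by (metis atLeast_iff le_refl less_one linorder_not_le)
  then show ?thesis using 1 by simp
qed

lemma is_cp_unique: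
  assumes "T \<in> \<T>" "is_cp p T" "is_cp q T"
  shows "p = q"
proof (rule ccontr)
  assume "p \<noteq> q"
  have "1 < \<beta> ^ n" using expanding n_pos by simp
  then obtain k where k: "max_length / \<bar>p - q\<bar> < (\<beta> ^ n) ^ k" using real_arch_pow by blast
  obtain s c where s: "(\<gamma> ^^ k) T = til s c" using tiling_tile[OF map_pow_in_tiling[OF assms(1)]] by blast
  have "p * \<beta> ^ (n * k) \<in> {s..s + l $ c}" "q * \<beta> ^ (n * k) \<in> {s..s + l $ c}"
    using assms(2,3) s unfolding is_cp_def by (metis supp_tile)+
  then have "\<bar>p * \<beta> ^ (n * k) - q * \<beta> ^ (n * k)\<bar> \<le> max_length"
    using max_length(1)[of c] by auto
  then have "\<bar>p - q\<bar> * \<beta> ^ (n * k) \<le> max_length"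
    using pow_pos[of "n * k"] by (simp add: abs_mult flip: left_diff_distrib)
  then show False using k[folded power_mult] \<open>p \<noteq> q\<close> by (simp add: field_simps)
qed

text \<open>The contracted supports form a decreasing sequence of compact intervals.\<close>

lemma is_cp_exists:
  assumes "T \<in> \<T>"
  shows "\<exists>p. is_cp p T"
proof -
  define F where "F k = {p. p * \<beta> ^ (n * k) \<in> supp ((\<gamma> ^^ k) T)}" for k
  have F: "\<exists>s t. s \<le> t \<and> F k = {s..t}" for k
  proof -
    obtain s c where s: "(\<gamma> ^^ k) T = til s c" using tiling_tile[OF map_pow_in_tiling[OF assms]] by blast
    have "F k = {s / \<beta> ^ (n * k)..(s + l $ c) / \<beta> ^ (n * k)}"
      using pow_pos[of "n * k"] by (auto simp: F_def s field_simps)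
    moreover have "s / \<beta> ^ (n * k) \<le> (s + l $ c) / \<beta> ^ (n * k)"
      using pow_pos[of "n * k"] length_pos[of c] by (intro divide_right_mono) auto
    ultimately show ?thesis by blast
  qed
  have "F (Suc k) \<subseteq> F k" for k
  proof
    fix p assume "p \<in> F (Suc k)"
    then have "(p * \<beta> ^ (n * k)) * \<beta> ^ n \<in> supp (\<gamma> ((\<gamma> ^^ k) T))"
      by (simp add: F_def power_add mult_ac)
    then show "p \<in> F k" unfolding F_def using map_supp[OF map_pow_in_tiling[OF assms]] by simp
  qed
  then have mono: "F k' \<subseteq> F k" if "k \<le> k'" for k k' using lift_Suc_antimono_le[of F] that by blast
  have "\<Inter>(range F) \<noteq> {}"
  proof (rule compact_nest)
    show "compact (F k)" "F k \<noteq> {}" for k using F[of k] by auto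
  qed (rule mono)
  then show ?thesis unfolding is_cp_def F_def by blast
qed

lemma cp_is_cp:
  assumes "T \<in> \<T>"
  shows "is_cp (cp T) T"
proof -
  have "cp T = (THE p. is_cp p T)"
    unfolding tiling_control_point_def using is_cp_alt[OF assms] by simp
  then show ?thesis using theI'[of "\<lambda>p. is_cp p T"] is_cp_exists[OF assms] is_cp_unique[OF assms] by metis
qed

lemma cp_map: "T \<in> \<T> \<Longrightarrow> cp (\<gamma> T) = \<beta> ^ n * cp T"
proof (rule is_cp_unique[of "\<gamma> T"])
  assume T: "T \<in> \<T>"
  show "\<gamma> T \<in> \<T>" "is_cp (cp (\<gamma> T)) (\<gamma> T)" using map_in_tiling[OF T] cp_is_cp by auto
  show "is_cp (\<beta> ^ n * cp T) (\<gamma> T)" unfolding is_cp_def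
  proof
    fix k
    have "cp T * \<beta> ^ (n * Suc k) \<in> supp ((\<gamma> ^^ Suc k) T)"
      using cp_is_cp[OF T] unfolding is_cp_def by blast
    then show "\<beta> ^ n * cp T * \<beta> ^ (n * k) \<in> supp ((\<gamma> ^^ k) (\<gamma> T))"
      by (simp add: funpow_swap1 power_add mult_ac)
  qed
qed

lemma cp_shift:
  assumes "T \<in> \<T>" "shift x T \<in> \<T>"
  shows "cp (shift x T) = cp T + x"
proof (rule is_cp_unique[OF assms(2) cp_is_cp[OF assms(2)]])
  show "is_cp (cp T + x) (shift x T)"
    unfolding is_cp_def
  proof
    fix k
    have "cp T * \<beta> ^ (n * k) \<in> supp ((\<gamma> ^^ k) T)" using cp_is_cp[OF assms(1)] unfolding is_cp_def by blast
    then show "(cp T + x) * \<beta> ^ (n * k) \<in> supp ((\<gamma> ^^ k) (shift x T))"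
      unfolding map_pow_shift[OF assms] by (auto simp: shift_def algebra_simps)
  qed
qed

lemma cp_shift_tile:
  assumes "til x i \<in> \<T>" "til x' i \<in> \<T>"
  shows "cp (til x' i) = cp (til x i) + (x' - x)"
  using cp_shift[of "til x i" "x' - x"] assms by simp

lemma cp_supp: "til x i \<in> \<T> \<Longrightarrow> x \<le> cp (til x i) \<and> cp (til x i) \<le> x + l $ i"
  using cp_is_cp[of "til x i"] unfolding is_cp_def by (auto dest: spec[of _ 0])

lemma control_point_shift:
  assumes "T \<in> \<T>"
  shows "control_point \<beta> \<T> n \<gamma> (shift x T) = cp T + x"
  unfolding control_point_def
proof (rule the_equality)
  show "\<exists>T'\<in>\<T>. \<exists>y. shift x T = shift y T' \<and> cp T + x = cp T' + y" using assms by blast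
next
  fix p assume "\<exists>T'\<in>\<T>. \<exists>y. shift x T = shift y T' \<and> p = cp T' + y"
  then obtain T' y where T': "T' \<in> \<T>" "shift x T = shift y T'" "p = cp T' + y" by blast
  have "T' = shift (x - y) T" using arg_cong[OF T'(2), of "shift (- y)"] by simp
  then show "p = cp T + x" using cp_shift[OF assms, of "x - y"] T' by simp
qed

lemma control_point_tile: "T \<in> \<T> \<Longrightarrow> control_point \<beta> \<T> n \<gamma> T = cp T"
  using control_point_shift[of T 0] by simp

lemma color_points_eq: "color_points \<beta> \<T> n \<gamma> i = {cp (til x i) |x. til x i \<in> \<T>}"
proof (intro equalityI subsetI)
  fix p assume "p \<in> color_points \<beta> \<T> n \<gamma> i"
  then obtain T where T: "T \<in> \<T>" "color T = i" "p = control_point \<beta> \<T> n \<gamma> T"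
    unfolding color_points_def by blast
  obtain x j where "T = til x j" using tiling_tile[OF T(1)] by blast
  with T show "p \<in> {cp (til x i) |x. til x i \<in> \<T>}" by (auto simp: control_point_tile)
next
  fix p assume "p \<in> {cp (til x i) |x. til x i \<in> \<T>}"
  then obtain x where "til x i \<in> \<T>" "p = cp (til x i)" by blast
  then have "p = control_point \<beta> \<T> n \<gamma> (til x i) \<and> til x i \<in> \<T> \<and> color (til x i) = i"
    by (simp add: control_point_tile)
  then show "p \<in> color_points \<beta> \<T> n \<gamma> i" unfolding color_points_def by blast
qed

lemma centered_proto_eq:
  assumes "til x i \<in> \<T>"
  shows "centered_proto \<beta> l \<T> n \<gamma> i = til (x - cp (til x i)) i"
  using control_point_shift[OF assms, of "- x"] by (simp add: centered_proto_def)

lemma same_color_difference: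
  assumes "p \<in> color_points \<beta> \<T> n \<gamma> i" "q \<in> color_points \<beta> \<T> n \<gamma> i"
  shows "p - q \<in> Xi"
proof -
  obtain x x' where x: "til x i \<in> \<T>" "til x' i \<in> \<T>" "p = cp (til x i)" "q = cp (til x' i)"
    using assms unfolding color_points_eq by blast
  then have "p - q = x - x'" using cp_shift_tile[of x' i x] by simp
  moreover have "til (x' + (x - x')) i \<in> \<T>" using x by simp
  ultimately show ?thesis using x(2) return_vectors_iff by metis
qed

lemma strong_coincidence_iff:
  assumes "\<And>i. til (base i) i \<in> \<T>"
  shows "strong_coincidence \<sigma> \<beta> l \<T> n \<gamma> \<longleftrightarrow>
    (\<forall>i j. \<exists>L\<ge>1. agree L i j (base j - (cp (til (base j) j) - cp (til (base i) i)) - base i))"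
proof -
  have "(Omega ^^ L) {centered_proto \<beta> l \<T> n \<gamma> i} \<inter> (Omega ^^ L) {centered_proto \<beta> l \<T> n \<gamma> j} \<noteq> {}
      \<longleftrightarrow> agree L i j (base j - (cp (til (base j) j) - cp (til (base i) i)) - base i)" for L i j
  proof -
    let ?c = "\<lambda>i. base i - cp (til (base i) i)"
    have "agree L i j (?c j - ?c i) \<longleftrightarrow>
        pat (\<beta> ^ L * ?c i) (iter L [i]) \<inter> pat (\<beta> ^ L * ?c j) (iter L [j]) \<noteq> {}"
      using agree_iff[of L i j "?c j - ?c i" "?c i"] patch_tile by fastforce
    moreover have "?c j - ?c i = base j - (cp (til (base j) j) - cp (til (base i) i)) - base i" by simp
    ultimately show ?thesis
      by (simp add: centered_proto_eq[OF assms] tile_subst_pow_tile)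
  qed
  then show ?thesis unfolding strong_coincidence_def by simp
qed

text \<open>Finitely many intervals have a common interior point as soon as they overlap pairwise.\<close>

lemma admissible_iff:
  assumes "\<And>i. til (base i) i \<in> \<T>"
  shows "admissible \<beta> l \<T> n \<gamma> \<longleftrightarrow>
    (\<forall>i j. overlapping i j (base j - (cp (til (base j) j) - cp (til (base i) i)) - base i))"
proof -
  let ?c = "\<lambda>i. base i - cp (til (base i) i)"
  define lo where "lo = Max (range ?c)"
  define hi where "hi = Min (range (\<lambda>i. ?c i + l $ i))"
  have int: "(\<Inter>i. supp (centered_proto \<beta> l \<T> n \<gamma> i)) = {lo..hi}"
    by (auto simp: centered_proto_eq[OF assms] lo_def hi_def)
  have "admissible \<beta> l \<T> n \<gamma> \<longleftrightarrow> lo < hi"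
    unfolding admissible_def int by (auto simp: interior_atLeastAtMost_real)
  also have "\<dots> \<longleftrightarrow> (\<forall>i j. ?c i < ?c j + l $ j)"
    unfolding lo_def hi_def by (auto simp: Max_less_iff Min_gr_iff)
  also have "\<dots> \<longleftrightarrow> (\<forall>i j. overlapping i j (?c j - ?c i))"
    unfolding overlapping_def by (auto simp: algebra_simps)
  finally show ?thesis by (simp add: algebra_simps)
qed

text \<open>Multiplication by a high power of \<open>\<beta>\<close> clears the denominators \<open>\<beta> ^ k\<close> of all generators involved, and
  return vectors are closed under inflation and sign change.\<close>

lemma group_closure_return_vectors:
  assumes "y \<in> group_closure (return_generators \<beta> \<T> n \<gamma> i)"
  shows "\<exists>K ys. set ys \<subseteq> Xi \<and> \<beta> ^ K * y = sum_list ys"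
  using assms
proof induction
  case (base s)
  show ?case
  proof (cases "s = 0")
    case True
    then show ?thesis by (intro exI[of _ 0] exI[of _ "[]"]) simp
  next
    case False
    with base have "s \<in> return_generators \<beta> \<T> n \<gamma> i" by simp
    then obtain k p q where pq: "s = (p - q) / \<beta> ^ k" "p \<in> color_points \<beta> \<T> n \<gamma> i" "q \<in> color_points \<beta> \<T> n \<gamma> i"
      unfolding return_generators_def by blast
    then have "p - q \<in> Xi" by (intro same_color_difference)
    then show ?thesis
      by (intro exI[of _ k] exI[of _ "[p - q]"]) (use pq(1) expanding in auto)
  qed
next
  case (diff s t)
  then obtain K ys K' zs where ys: "set ys \<subseteq> Xi" "\<beta> ^ K * s = sum_list ys"
    and zs: "set zs \<subseteq> Xi" "\<beta> ^ K' * t = sum_list zs" by blast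
  have "\<beta> ^ (K + K') * (s - t)
      = sum_list (map ((*) (\<beta> ^ K')) ys @ map ((*) (- (\<beta> ^ K))) zs)"
    by (simp only: sum_list_append sum_list_scale ys(2)[symmetric] zs(2)[symmetric])
       (simp add: power_add algebra_simps)
  moreover have "set (map ((*) (\<beta> ^ K')) ys @ map ((*) (- (\<beta> ^ K))) zs) \<subseteq> Xi"
    using ys(1) zs(1) return_vectors_scale return_vectors_minus by auto
  ultimately show ?case by metis
qed

lemma overlap_coincidence_imp_strong:
  assumes oc: "overlap_coincidence \<sigma> \<beta> l \<T>" and adm: "admissible \<beta> l \<T> n \<gamma>"
    and diff: "{x - y |x y. x \<in> (\<Union>j. color_points \<beta> \<T> n \<gamma> j) \<and> y \<in> (\<Union>j. color_points \<beta> \<T> n \<gamma> j)}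
               \<subseteq> group_closure (return_generators \<beta> \<T> n \<gamma> i0)"
  shows "strong_coincidence \<sigma> \<beta> l \<T> n \<gamma>"
proof -
  obtain base where base: "\<And>i. til (base i) i \<in> \<T>" using all_colors by metis
  show ?thesis
    unfolding strong_coincidence_iff[OF base]
  proof (intro allI)
    fix i j
    let ?y = "cp (til (base j) j) - cp (til (base i) i)"
    have "?y \<in> group_closure (return_generators \<beta> \<T> n \<gamma> i0)"
      using diff base unfolding color_points_eq by blast
    then obtain K ys where "set ys \<subseteq> Xi" "\<beta> ^ K * ?y = sum_list ys"
      using group_closure_return_vectors by blast
    moreover have "overlapping i j (base j - ?y - base i)"
      using adm unfolding admissible_iff[OF base] by blast
    ultimately show "\<exists>L\<ge>1. agree L i j (base j - ?y - base i)"
      by (intro overlap_coincidence_agree[OF oc base base])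
  qed
qed

end

lemma (in suspension) overlap_coincidence_imp_multiple:
  assumes "overlap_coincidence \<sigma> \<beta> l \<T>" "1 \<le> n"
  shows "multiple_strong_coincidence \<sigma> \<beta> l \<T> n"
  unfolding multiple_strong_coincidence_def
proof (intro allI impI, elim conjE exE)
  fix \<gamma> i0
  assume a: "tile_map \<sigma> \<beta> l \<T> n \<gamma>" "admissible \<beta> l \<T> n \<gamma>"
    "{x - y |x y. x \<in> (\<Union>j. color_points \<beta> \<T> n \<gamma> j) \<and> y \<in> (\<Union>j. color_points \<beta> \<T> n \<gamma> j)}
       \<subseteq> group_closure (return_generators \<beta> \<T> n \<gamma> i0)"
  interpret tile_mapped \<sigma> \<beta> l \<T> n \<gamma> using a(1) assms(2) by unfold_locales
  show "strong_coincidence \<sigma> \<beta> l \<T> n \<gamma>"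
    by (rule overlap_coincidence_imp_strong[OF assms(1) a(2,3)])
qed

section \<open>Finitely many overlap types\<close>

lemma iter_prefix_split:
  assumes "(subst_word \<sigma> ^^ K) w = u @ v"
  shows "u = (subst_word \<sigma> ^^ K) w \<or> (\<exists>w1 d w2 u' v'. w = w1 @ d # w2 \<and>
     u = (subst_word \<sigma> ^^ K) w1 @ u' \<and> (subst_word \<sigma> ^^ K) [d] = u' @ v')"
  using assms
proof (induction w arbitrary: u)
  case Nil
  then show ?case by simp
next
  case (Cons d w)
  let ?it = "(subst_word \<sigma> ^^ K)"
  have "?it [d] @ ?it w = u @ v" using Cons.prems iter_append[of K \<sigma> "[d]" w] by simp
  then consider r where "?it [d] = u @ r" | r where "u = ?it [d] @ r" "?it w = r @ v"
    by (auto simp: append_eq_append_conv2)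
  then show ?case
  proof cases
    case 1
    then have "d # w = [] @ d # w \<and> u = ?it [] @ u \<and> ?it [d] = u @ r" by simp
    then show ?thesis by blast
  next
    case 2
    have dw: "?it (d # w') = ?it [d] @ ?it w'" for w' using iter_append[of K \<sigma> "[d]" w'] by simp
    from Cons.IH[OF 2(2)] show ?thesis
    proof
      assume "r = ?it w"
      then show ?thesis using 2(1) dw[of w] by simp
    next
      assume "\<exists>w1 d' w2 u' v'. w = w1 @ d' # w2 \<and> r = ?it w1 @ u' \<and> ?it [d'] = u' @ v'"
      then obtain w1 d' w2 u' v' where "w = w1 @ d' # w2" "r = ?it w1 @ u'" "?it [d'] = u' @ v'"
        by blast
      then have "d # w = (d # w1) @ d' # w2 \<and> u = ?it (d # w1) @ u' \<and> ?it [d'] = u' @ v'"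
        using 2(1) dw[of w1] by simp
      then show ?thesis by blast
    qed
  qed
qed

text \<open>The Perron--Frobenius argument: subtract the largest multiple of \<open>l\<close> that leaves a nonnegative
  vector \<open>u\<close>. It vanishes at some letter, hence on all letters of every iterate of that letter, and by
  primitivity these are all letters.\<close>

lemma (in suspension) eigenvector_unique:
  assumes f: "\<And>j. (\<Sum>c\<leftarrow>\<sigma> j. f c) = \<beta> * f j"
  shows "\<exists>\<alpha>. \<forall>c. f c = \<alpha> * l $ c"
proof -
  define \<alpha> where "\<alpha> = Min (range (\<lambda>c. f c / l $ c))"
  define u where "u c = f c - \<alpha> * l $ c" for c
  have nonneg: "0 \<le> u c" for c
  proof -
    have "\<alpha> \<le> f c / l $ c" unfolding \<alpha>_def by simp
    then show ?thesis using length_pos[of c] by (simp add: u_def field_simps)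
  qed
  have "\<alpha> \<in> range (\<lambda>c. f c / l $ c)" unfolding \<alpha>_def by (intro Min_in) auto
  then obtain c0 where "\<alpha> = f c0 / l $ c0" by blast
  then have zero: "u c0 = 0" using length_pos[of c0] by (simp add: u_def)
  have "(\<Sum>c\<leftarrow>\<sigma> j. u c) = \<beta> * u j" for j
  proof -
    have sum_u: "(\<Sum>c\<leftarrow>w. u c) = (\<Sum>c\<leftarrow>w. f c) - \<alpha> * len w" for w
      by (induction w) (auto simp: u_def algebra_simps)
    show ?thesis unfolding sum_u f eigen by (simp add: u_def algebra_simps)
  qed
  then have "(\<Sum>c\<leftarrow>subst_word \<sigma> w. u c) = \<beta> * (\<Sum>c\<leftarrow>w. u c)" for w
    by (induction w) (auto simp: algebra_simps)
  then have pow: "(\<Sum>c\<leftarrow>iter k w. u c) = \<beta> ^ k * (\<Sum>c\<leftarrow>w. u c)" for k w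
    by (induction k) auto
  obtain k where k: "\<And>i. i \<in> set (iter k [c0])" using primitive by blast
  have "(\<Sum>c\<leftarrow>iter k [c0]. u c) = 0" using pow[of k "[c0]"] zero by simp
  then have "u c = 0" for c
    using sum_list_nonneg_eq_0_iff[of "map u (iter k [c0])"] nonneg k[of c] by auto
  then show ?thesis by (intro exI[of _ \<alpha>]) (simp add: u_def)
qed

locale pisot_suspension = suspension +
  assumes pisot: "pisot_number \<beta>"
begin

text \<open>Multiplying the equation \<open>p(\<beta>) = 0\<close> by \<open>\<beta> ^ k * x\<close> and applying the \<open>\<rat>\<close>-linear \<open>f\<close> gives a linear
  recurrence for \<open>f (\<beta> ^ k * x)\<close> with characteristic polynomial \<open>p\<close>. The first-order difference with respect
  to \<open>\<beta>\<close> solves the recurrence of the remaining, contracting roots.\<close>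

lemma coordinate_geometric_decay:
  assumes f: "rational_functional f"
  obtains A where "geometric_decay (\<lambda>k. real_of_rat (f (\<beta> ^ k * x)) - A * \<beta> ^ k)"
proof -
  obtain p h where p: "map_poly of_rat p = [:- complex_of_real \<beta>, 1:] * h" and h: "h \<noteq> 0"
    and roots: "\<And>z. poly h z = 0 \<Longrightarrow> cmod z < 1"
    using pisot_annihilator[OF pisot] by blast
  define u where "u k = real_of_rat (f (\<beta> ^ k * x))" for k
  have "poly (map_poly of_rat p) (complex_of_real \<beta>) = 0" unfolding p by simp
  then have root: "poly (map_poly of_rat p) \<beta> = 0"
    unfolding poly_map_poly_of_rat_of_real by simp
  have deg: "degree p = Suc (degree h)"
  proof -
    have "degree (map_poly of_rat p :: complex poly) = degree p"
      by (rule degree_map_poly) simp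
    moreover have "degree ([:- complex_of_real \<beta>, 1:] * h) = Suc (degree h)"
      using h by (subst degree_mult_eq) auto
    ultimately show ?thesis unfolding p by simp
  qed
  have rec: "(\<Sum>i\<le>degree p. real_of_rat (coeff p i) * u (k + i)) = 0" for k
  proof -
    have "(\<Sum>i\<le>degree p. real_of_rat (coeff p i) * u (k + i))
        = real_of_rat (\<Sum>i\<le>degree p. f (of_rat (coeff p i) * (\<beta> ^ (k + i) * x)))"
      by (simp add: u_def of_rat_sum of_rat_mult rational_functional_scale[OF f])
    also have "(\<Sum>i\<le>degree p. f (of_rat (coeff p i) * (\<beta> ^ (k + i) * x)))
        = f (\<Sum>i\<le>degree p. of_rat (coeff p i) * (\<beta> ^ (k + i) * x))"
      by (simp add: rational_functional_sum[OF _ f])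
    also have "(\<Sum>i\<le>degree p. real_of_rat (coeff p i) * (\<beta> ^ (k + i) * x))
        = \<beta> ^ k * x * poly (map_poly of_rat p) \<beta>"
      by (simp add: poly_altdef degree_map_poly coeff_map_poly sum_distrib_left power_add mult_ac)
    finally show ?thesis using root rational_functional_zero[OF f] by simp
  qed
  have c: "complex_of_real (real_of_rat q) = of_rat q" for q by (cases q) (simp add: of_rat_rat)
  have zero: "(\<Sum>i\<le>degree h. coeff h i * complex_of_real (u (Suc (k + i)) - \<beta> * u (k + i))) = 0" for k
  proof -
    have "(\<Sum>i\<le>degree h. coeff h i * complex_of_real (u (Suc (k + i)) - \<beta> * u (k + i)))
        = (\<Sum>i\<le>Suc (degree h). coeff ([:- complex_of_real \<beta>, 1:] * h) i * complex_of_real (u (k + i)))"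
      using recurrence_linear_factor[where h = h and r = "complex_of_real \<beta>" and k = k
          and u = "\<lambda>k. complex_of_real (u k)"] by simp
    also have "\<dots> = (\<Sum>i\<le>degree p. complex_of_real (real_of_rat (coeff p i) * u (k + i)))"
      unfolding p[symmetric] deg by (intro sum.cong refl) (simp add: coeff_map_poly c)
    also have "\<dots> = complex_of_real (\<Sum>i\<le>degree p. real_of_rat (coeff p i) * u (k + i))" by simp
    finally show ?thesis unfolding rec by simp
  qed
  have "geometric_decay (\<lambda>k. \<Sum>i\<le>degree h. coeff h i * complex_of_real (u (Suc (k + i)) - \<beta> * u (k + i)))"
    unfolding zero geometric_decay_def by (intro exI[of _ 0]) simp
  with h roots have "geometric_decay (\<lambda>k. complex_of_real (u (Suc k) - \<beta> * u k))"
    by (rule geometric_decay_recurrence)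
  then have "geometric_decay (\<lambda>k. u (Suc k) - \<beta> * u k)"
    unfolding geometric_decay_def norm_of_real real_norm_def .
  then obtain A where "geometric_decay (\<lambda>k. u k - A * \<beta> ^ k)"
    by (rule geometric_decay_dominant_root[OF expanding])
  then show ?thesis using that[of A] by (simp only: u_def)
qed

text \<open>The leading coefficients \<open>A c\<close> of \<open>f (\<beta> ^ k * l $ c)\<close> form an eigenvector for \<open>\<beta>\<close>, because \<open>f\<close> is
  additive and \<open>\<beta> * l $ c\<close> is the sum of the lengths of the letters of \<open>\<sigma> c\<close>. Hence they are a multiple of
  \<open>l\<close>.\<close>

lemma coordinate_proportional:
  assumes f: "rational_functional f"
  shows "\<exists>\<alpha> C \<rho>. 0 \<le> \<rho> \<and> \<rho> < 1 \<and>
    (\<forall>c k. \<bar>real_of_rat (f (\<beta> ^ k * l $ c)) - \<alpha> * (\<beta> ^ k * l $ c)\<bar> \<le> C * \<rho> ^ k)"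
proof -
  define u where "u c k = real_of_rat (f (\<beta> ^ k * l $ c))" for c k
  have "\<exists>A. geometric_decay (\<lambda>k. u c k - A * \<beta> ^ k)" for c
    using coordinate_geometric_decay[OF f] unfolding u_def by blast
  then obtain A where A: "\<And>c. geometric_decay (\<lambda>k. u c k - A c * \<beta> ^ k)" by metis
  have lim: "(\<lambda>k. u c k / \<beta> ^ k) \<longlonglongrightarrow> A c" for c by (rule geometric_decay_tendsto[OF expanding A])
  have "(\<Sum>d\<leftarrow>\<sigma> c. A d) = \<beta> * A c" for c
  proof -
    have u_word: "(\<Sum>d\<leftarrow>w. u d k) = real_of_rat (f (\<beta> ^ k * len w))" for w k
      by (induction w)
        (auto simp: u_def distrib_left rational_functional_add[OF f] rational_functional_zero[OF f] of_rat_add)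
    have u_Suc: "(\<Sum>d\<leftarrow>\<sigma> c. u d k) = u c (Suc k)" for k
      unfolding u_word by (simp add: u_def eigen mult_ac)
    have lim_word: "(\<lambda>k. (\<Sum>d\<leftarrow>w. u d k) / \<beta> ^ k) \<longlonglongrightarrow> (\<Sum>d\<leftarrow>w. A d)" for w
    proof (induction w)
      case (Cons d w)
      from tendsto_add[OF lim[of d] Cons.IH] show ?case by (simp add: add_divide_distrib)
    qed simp
    have 1: "(\<lambda>k. u c (Suc k) / \<beta> ^ k) \<longlonglongrightarrow> (\<Sum>d\<leftarrow>\<sigma> c. A d)"
      using lim_word[of "\<sigma> c"] unfolding u_Suc .
    have 2: "(\<lambda>k. \<beta> * (u c (Suc k) / \<beta> ^ Suc k)) \<longlonglongrightarrow> \<beta> * A c"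
      by (intro tendsto_mult tendsto_const LIMSEQ_Suc[OF lim])
    have 3: "\<beta> * (u c (Suc k) / \<beta> ^ Suc k) = u c (Suc k) / \<beta> ^ k" for k
      using expanding by simp
    show ?thesis by (rule LIMSEQ_unique[OF 1 2[unfolded 3]])
  qed
  then obtain \<alpha> where \<alpha>: "\<And>c. A c = \<alpha> * l $ c" using eigenvector_unique[of A] by blast
  obtain C \<rho> where C: "\<And>c. 0 \<le> \<rho> c \<and> \<rho> c < 1 \<and> (\<forall>k. \<bar>u c k - A c * \<beta> ^ k\<bar> \<le> C c * \<rho> c ^ k)"
    using A unfolding geometric_decay_def real_norm_def by metis
  define C' where "C' = Max (range C)"
  define \<rho>' where "\<rho>' = Max (range \<rho>)"
  have "0 \<le> C c" for c
  proof -
    have "\<bar>u c 0 - A c * \<beta> ^ 0\<bar> \<le> C c * \<rho> c ^ 0" using C by blast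
    from order_trans[OF abs_ge_zero this] show ?thesis by simp
  qed
  then have C': "0 \<le> C c \<and> C c \<le> C'" for c by (simp add: C'_def)
  have \<rho>'_ge: "\<rho> c \<le> \<rho>'" for c by (simp add: \<rho>'_def)
  have "\<rho>' < 1" unfolding \<rho>'_def using C by (auto simp: Max_less_iff)
  moreover have "0 \<le> \<rho>'" using \<rho>'_ge[of undefined] C[of undefined] by linarith
  moreover have "\<bar>u c k - \<alpha> * (\<beta> ^ k * l $ c)\<bar> \<le> C' * \<rho>' ^ k" for c k
  proof -
    have "\<bar>u c k - \<alpha> * (\<beta> ^ k * l $ c)\<bar> \<le> C c * \<rho> c ^ k" using C[of c] by (simp add: \<alpha> mult_ac)
    also have "\<dots> \<le> C' * \<rho>' ^ k"
      using C[of c] C'[of c] \<rho>'_ge[of c] by (intro mult_mono power_mono) auto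
    finally show ?thesis .
  qed
  ultimately show ?thesis unfolding u_def by blast
qed

text \<open>A prefix of an iterate has length \<open>\<Sum>k<K. \<beta> ^ k * len (w k)\<close> with prefixes \<open>w k\<close> of substituted letters,
  up to a last single letter. The errors of the summands are dominated by a geometric series, so the
  bound is uniform in \<open>K\<close>.\<close>

lemma prefix_coordinate_bound:
  assumes f: "rational_functional f"
  shows "\<exists>\<alpha> E. \<forall>K c u v. iter K [c] = u @ v \<longrightarrow> \<bar>real_of_rat (f (len u)) - \<alpha> * len u\<bar> \<le> E"
proof -
  obtain \<alpha> C \<rho> where \<rho>: "0 \<le> \<rho>" "\<rho> < 1"
    and C: "\<And>c k. \<bar>real_of_rat (f (\<beta> ^ k * l $ c)) - \<alpha> * (\<beta> ^ k * l $ c)\<bar> \<le> C * \<rho> ^ k"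
    using coordinate_proportional[OF f] by blast
  define g where "g x = real_of_rat (f x) - \<alpha> * x" for x
  have g_add: "g (x + y) = g x + g y" for x y
    by (simp add: g_def rational_functional_add[OF f] of_rat_add distrib_left)
  have g_0: "g 0 = 0" by (simp add: g_def rational_functional_zero[OF f])
  have C0: "0 \<le> C" using order_trans[OF abs_ge_zero C[of 0]] by simp
  have word: "\<bar>g (\<beta> ^ k * len w)\<bar> \<le> real (length w) * (C * \<rho> ^ k)" for k w
  proof (induction w)
    case (Cons c w)
    have "\<bar>g (\<beta> ^ k * len (c # w))\<bar> \<le> \<bar>g (\<beta> ^ k * l $ c)\<bar> + \<bar>g (\<beta> ^ k * len w)\<bar>"
      by (simp add: distrib_left g_add abs_triangle_ineq)
    also have "\<dots> \<le> C * \<rho> ^ k + real (length w) * (C * \<rho> ^ k)"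
      using C[of k c] Cons.IH by (intro add_mono) (auto simp: g_def)
    finally show ?case by (simp add: algebra_simps)
  qed (simp add: g_0)
  define M where "M = Max (range (\<lambda>c. length (\<sigma> c)))"
  have M: "length (\<sigma> c) \<le> M" for c by (simp add: M_def)
  have main: "\<bar>g (len u)\<bar> \<le> C + (\<Sum>k<K. real M * C * \<rho> ^ k)" if "iter K [c] = u @ v" for K c u v
    using that
  proof (induction K arbitrary: c u v)
    case 0
    then have "u = [] \<or> u = [c]" by (cases u) auto
    then show ?case using word[of 0 "[c]"] C0 by (auto simp: g_0)
  next
    case (Suc K)
    have "iter K (\<sigma> c) = u @ v" using Suc.prems by (simp add: funpow_Suc_right del: funpow.simps)
    from iter_prefix_split[OF this] show ?case
    proof
      assume "u = iter K (\<sigma> c)"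
      then have "\<bar>g (len u)\<bar> \<le> real (length (\<sigma> c)) * (C * \<rho> ^ K)" using word by (simp add: len_iter)
      also have "\<dots> \<le> real M * (C * \<rho> ^ K)" using M C0 \<rho>(1) by (intro mult_right_mono) auto
      also have "\<dots> \<le> C + (\<Sum>k<Suc K. real M * C * \<rho> ^ k)"
        using C0 \<rho>(1) by (simp add: sum_nonneg mult.assoc)
      finally show ?thesis .
    next
      assume "\<exists>w1 d w2 u' v'. \<sigma> c = w1 @ d # w2 \<and> u = iter K w1 @ u' \<and> iter K [d] = u' @ v'"
      then obtain w1 d w2 u' v' where w: "\<sigma> c = w1 @ d # w2" "u = iter K w1 @ u'" "iter K [d] = u' @ v'"
        by blast
      have "\<bar>g (len u)\<bar> \<le> \<bar>g (\<beta> ^ K * len w1)\<bar> + \<bar>g (len u')\<bar>"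
        unfolding w(2) by (simp add: len_iter g_add abs_triangle_ineq)
      also have "\<dots> \<le> real (length w1) * (C * \<rho> ^ K) + (C + (\<Sum>k<K. real M * C * \<rho> ^ k))"
        by (intro add_mono word Suc.IH[OF w(3)])
      also have "real (length w1) * (C * \<rho> ^ K) \<le> real M * (C * \<rho> ^ K)"
        using M[of c] C0 \<rho>(1) by (intro mult_right_mono) (auto simp: w(1))
      finally show ?thesis by (simp add: mult.assoc)
    qed
  qed
  have geo: "(\<Sum>k<K. real M * C * \<rho> ^ k) \<le> real M * C / (1 - \<rho>)" for K
  proof -
    have "(\<Sum>k<K. \<rho> ^ k) = (1 - \<rho> ^ K) / (1 - \<rho>)" using \<rho> by (simp add: sum_gp_strict)
    also have "\<dots> \<le> 1 / (1 - \<rho>)" using \<rho> by (intro divide_right_mono) auto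
    finally have "real M * C * (\<Sum>k<K. \<rho> ^ k) \<le> real M * C * (1 / (1 - \<rho>))"
      using C0 by (intro mult_left_mono) auto
    then show ?thesis by (simp add: sum_distrib_left)
  qed
  have "\<bar>g (len u)\<bar> \<le> C + real M * C / (1 - \<rho>)" if "iter K [c] = u @ v" for K c u v
    by (rule order_trans[OF main[OF that] add_left_mono[OF geo]])
  then show ?thesis unfolding g_def by blast
qed

lemma len_in_lattice: "len w \<in> group_closure (range (($) l))"
  by (induction w) (auto intro: group_closure_add group_closure.base)

text \<open>An offset is a difference of two differences of tile positions and is bounded by the longest tile
  length. Hence each of the separating coordinates is bounded on offsets; these coordinates have a common
  denominator on the lattice.\<close>

lemma finite_overlap_types: "finite overlap_types"
proof -
  let ?L = "group_closure (range (($) l))"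
  obtain \<Phi> where \<Phi>: "finite \<Phi>" "\<And>f. f \<in> \<Phi> \<Longrightarrow> rational_functional f"
    and sep: "\<And>z. z \<in> ?L \<Longrightarrow> (\<And>f. f \<in> \<Phi> \<Longrightarrow> f z = 0) \<Longrightarrow> z = 0"
    using separating_rational_functionals[of "range (($) l)"] by auto
  have "finite ((\<lambda>(f, c). f (l $ c)) ` (\<Phi> \<times> UNIV))" using \<Phi>(1) by simp
  from common_denominator[OF this] obtain N where N: "0 < N"
    and Nf: "\<And>f c. f \<in> \<Phi> \<Longrightarrow> of_nat N * f (l $ c) \<in> \<int>" by auto
  have NL: "of_nat N * f z \<in> \<int>" if f: "f \<in> \<Phi>" and "z \<in> ?L" for f z
    using that(2)
  proof induction
    case (base s)
    then show ?case using Nf[OF f] rational_functional_zero[OF \<Phi>(2)[OF f]] by auto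
  next
    case (diff s t)
    then show ?case by (simp add: rational_functional_diff[OF \<Phi>(2)[OF f]] right_diff_distrib)
  qed
  have "\<exists>\<alpha> E. \<forall>K c u v. iter K [c] = u @ v \<longrightarrow> \<bar>real_of_rat (f (len u)) - \<alpha> * len u\<bar> \<le> E"
    if "f \<in> \<Phi>" for f
    by (rule prefix_coordinate_bound[OF \<Phi>(2)[OF that]])
  then obtain \<alpha> E where E: "\<And>f K c u v. f \<in> \<Phi> \<Longrightarrow> iter K [c] = u @ v \<Longrightarrow>
      \<bar>real_of_rat (f (len u)) - \<alpha> f * len u\<bar> \<le> E f" by metis
  define R where "R f = 4 * E f + \<bar>\<alpha> f\<bar> * max_length" for f
  define F where "F f = {q::rat. of_nat N * q \<in> \<int> \<and> \<bar>real_of_rat q\<bar> \<le> R f}" for f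
  define Z where "Z = {z \<in> ?L. \<forall>f\<in>\<Phi>. f z \<in> F f}"
  have "finite Z"
  proof (rule inj_on_finite)
    show "inj_on (\<lambda>z. \<lambda>f\<in>\<Phi>. f z) Z"
    proof (rule inj_onI)
      fix z z' assume z: "z \<in> Z" "z' \<in> Z" and eq: "(\<lambda>f\<in>\<Phi>. f z) = (\<lambda>f\<in>\<Phi>. f z')"
      have "f (z - z') = 0" if "f \<in> \<Phi>" for f
        using fun_cong[OF eq, of f] that by (simp add: rational_functional_diff[OF \<Phi>(2)])
      moreover have "z - z' \<in> ?L" using z by (auto simp: Z_def intro: group_closure.diff)
      ultimately have "z - z' = 0" using sep by blast
      then show "z = z'" by simp
    qed
    show "(\<lambda>z. \<lambda>f\<in>\<Phi>. f z) ` Z \<subseteq> PiE \<Phi> F" by (auto simp: Z_def)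
    show "finite (PiE \<Phi> F)" unfolding F_def using \<Phi>(1) N by (intro finite_PiE finite_bounded_rationals)
  qed
  have diff: "x - x' \<in> ?L" "\<And>f. f \<in> \<Phi> \<Longrightarrow> \<bar>real_of_rat (f (x - x')) - \<alpha> f * (x - x')\<bar> \<le> 2 * E f"
    if xx': "til x i \<in> \<T>" "til x' i' \<in> \<T>" for x i x' i'
  proof -
    obtain K c u v u' v' where K: "iter K [c] = u @ i # v" "iter K [c] = u' @ i' # v'"
      and x: "x - x' = len u - len u'"
      by (rule tiling_repetitive[OF xx'])
    show "x - x' \<in> ?L" unfolding x by (intro group_closure.diff len_in_lattice)
    fix f assume f: "f \<in> \<Phi>"
    have "real_of_rat (f (x - x')) - \<alpha> f * (x - x')
       = (real_of_rat (f (len u)) - \<alpha> f * len u) - (real_of_rat (f (len u')) - \<alpha> f * len u')"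
      unfolding x by (simp add: rational_functional_diff[OF \<Phi>(2)[OF f]] of_rat_diff right_diff_distrib)
    then show "\<bar>real_of_rat (f (x - x')) - \<alpha> f * (x - x')\<bar> \<le> 2 * E f"
      using E[OF f K(1)] E[OF f K(2)] by linarith
  qed
  have "overlap_types \<subseteq> UNIV \<times> UNIV \<times> Z"
  proof (clarify, intro conjI SigmaI UNIV_I)
    fix i j z assume "(i, j, z) \<in> overlap_types"
    then obtain x y where ov: "overlapping i j z" and y: "y \<in> Xi"
      and x: "til x i \<in> \<T>" "til (x + z + y) j \<in> \<T>"
      unfolding overlap_types_def by blast
    obtain t c where t: "til t c \<in> \<T>" "til (t + y) c \<in> \<T>" using y return_vectors_iff by blast
    have z: "z = ((x + z + y) - x) - ((t + y) - t)" by simp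
    have zL: "z \<in> ?L" by (subst z) (intro group_closure.diff[OF diff(1)[OF x(2,1)] diff(1)[OF t(2,1)]])
    have "\<bar>z\<bar> \<le> max_length"
      using ov max_length(1)[of i] max_length(1)[of j] unfolding overlapping_def by linarith
    have "f z \<in> F f" if f: "f \<in> \<Phi>" for f
    proof -
      define A B where "A = x + z + y - x" and "B = t + y - t"
      have zAB: "z = A - B" by (simp add: A_def B_def)
      have "real_of_rat (f z) - \<alpha> f * z
          = (real_of_rat (f A) - \<alpha> f * A) - (real_of_rat (f B) - \<alpha> f * B)"
        by (simp add: zAB rational_functional_diff[OF \<Phi>(2)[OF f]] of_rat_diff right_diff_distrib)
      then have "\<bar>real_of_rat (f z) - \<alpha> f * z\<bar> \<le> 4 * E f"
        using diff(2)[OF x(2,1) f, folded A_def] diff(2)[OF t(2,1) f, folded B_def] by linarith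
      moreover have "\<bar>\<alpha> f * z\<bar> \<le> \<bar>\<alpha> f\<bar> * max_length"
        using \<open>\<bar>z\<bar> \<le> max_length\<close> by (simp add: abs_mult mult_left_mono)
      ultimately have "\<bar>real_of_rat (f z)\<bar> \<le> R f" unfolding R_def by linarith
      then show ?thesis using NL[OF f zL] by (simp add: F_def)
    qed
    then show "z \<in> Z" using zL by (simp add: Z_def)
  qed
  then show ?thesis by (rule finite_subset) (simp add: \<open>finite Z\<close>)
qed

end

section \<open>Cycles of overlaps without coincidence\<close>

lemma adjacent_distinct:
  assumes "d \<in> set w" "e \<in> set w" "d \<noteq> e"
  shows "\<exists>u a b v. w = u @ a # b # v \<and> a \<noteq> b"
  using assms
proof (induction w)
  case (Cons a w)
  show ?case
  proof (cases w)
    case Nil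
    then show ?thesis using Cons.prems by simp
  next
    case (Cons b w')
    show ?thesis
    proof (cases "a = b")
      case True
      then have "\<exists>u a b v. w = u @ a # b # v \<and> a \<noteq> b"
        using Cons Cons.prems Cons.IH by auto
      then obtain u a' b' v where "w = u @ a' # b' # v" "a' \<noteq> b'" by blast
      then have "a # w = (a # u) @ a' # b' # v \<and> a' \<noteq> b'" by simp
      then show ?thesis by blast
    next
      case False
      then have "a # w = [] @ a # b # w' \<and> a \<noteq> b" using Cons by simp
      then show ?thesis by blast
    qed
  qed
qed simp

context suspension
begin

fun bad :: "'a \<times> 'a \<times> real \<Rightarrow> bool" where
  "bad (i, j, z) \<longleftrightarrow> (i, j, z) \<in> overlap_types \<and> (\<forall>k. \<not> agree k i j z)"

fun descend :: "nat \<Rightarrow> 'a \<times> 'a \<times> real \<Rightarrow> 'a \<times> 'a \<times> real \<Rightarrow> bool" where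
  "descend m (i, j, z) (i', j', z') \<longleftrightarrow> (\<exists>u v u' v'. iter m [i] = u @ i' # v \<and>
     iter m [j] = u' @ j' # v' \<and> z' = \<beta> ^ m * z + len u' - len u)"

lemma descend_refl: "descend 0 t t"
proof (cases t)
  case (fields i j z)
  have "iter 0 [i] = [] @ i # [] \<and> iter 0 [j] = [] @ j # [] \<and> z = \<beta> ^ 0 * z + len [] - len []"
    by simp
  then show ?thesis unfolding fields descend.simps by blast
qed

lemma iter_descend:
  assumes "iter m [i] = u @ i' # v" "iter m' [i'] = a @ i'' # b"
  shows "iter (m' + m) [i] = (iter m' u @ a) @ i'' # (b @ iter m' v)"
  using assms iter_split[of m' \<sigma> u i' v] by (simp add: funpow_add)

lemma descend_trans:
  assumes "descend m t t'" "descend m' t' t''"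
  shows "descend (m' + m) t t''"
proof -
  obtain i j z i' j' z' i'' j'' z'' where t: "t = (i, j, z)" "t' = (i', j', z')" "t'' = (i'', j'', z'')"
    by (metis prod.collapse)
  obtain u v u' v' where 1: "iter m [i] = u @ i' # v" "iter m [j] = u' @ j' # v'"
    "z' = \<beta> ^ m * z + len u' - len u"
    using assms(1) unfolding t descend.simps by blast
  obtain a b a' b' where 2: "iter m' [i'] = a @ i'' # b" "iter m' [j'] = a' @ j'' # b'"
    "z'' = \<beta> ^ m' * z' + len a' - len a"
    using assms(2) unfolding t descend.simps by blast
  have "z'' = \<beta> ^ (m' + m) * z + len (iter m' u' @ a') - len (iter m' u @ a)"
    by (simp add: 1(3) 2(3) len_iter power_add algebra_simps)
  then show ?thesis
    unfolding t descend.simps using iter_descend[OF 1(1) 2(1)] iter_descend[OF 1(2) 2(2)] by blast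
qed

lemma descend_pow: "descend m t t \<Longrightarrow> descend (m * k) t t"
proof (induction k)
  case 0
  then show ?case using descend_refl by simp
next
  case (Suc k)
  from descend_trans[OF Suc.IH[OF Suc.prems] Suc.prems] show ?case by simp
qed

lemma descend_bad:
  assumes "bad (i, j, z)" "descend m (i, j, z) (i', j', z')" "overlapping i' j' z'"
  shows "bad (i', j', z')"
proof -
  obtain u v u' v' where 1: "iter m [i] = u @ i' # v" "iter m [j] = u' @ j' # v'"
    "z' = \<beta> ^ m * z + len u' - len u"
    using assms(2) unfolding descend.simps by blast
  obtain x y where x: "til x i \<in> \<T>" "til (x + z + y) j \<in> \<T>" "y \<in> Xi"
    using assms(1) unfolding bad.simps overlap_types_def by blast
  have "til (\<beta> ^ m * x + len u) i' \<in> \<T>" by (rule patch_tile_in_tiling[OF x(1) 1(1)])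
  moreover have "til (\<beta> ^ m * x + len u + z' + \<beta> ^ m * y) j' \<in> \<T>"
    using patch_tile_in_tiling[OF x(2) 1(2)] by (simp add: 1(3) algebra_simps)
  ultimately have ot: "(i', j', z') \<in> overlap_types"
    unfolding overlap_types_def using assms(3) return_vectors_scale[OF x(3)] by blast
  have "\<not> agree k i' j' z'" for k
  proof
    assume ag: "agree k i' j' z'"
    have "til (len u) i' \<in> pat 0 (iter m [i])" unfolding 1(1) using patch_split[where l = l and x = 0 and u = u and c = i' and v = v] by simp
    moreover have "til (\<beta> ^ m * z + len u') j' \<in> pat (\<beta> ^ m * z) (iter m [j])"
      unfolding 1(2) by (rule patch_split)
    ultimately have "agree (k + m) i j z"
      by (rule agree_descend) (use ag in \<open>simp add: 1(3)\<close>)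
    then show False using assms(1) by simp
  qed
  with ot show ?thesis by simp
qed

text \<open>Agreement persists under inflation. If every type agreed at some stage, then by finiteness all
  would agree at a common one.\<close>

lemma bad_exists:
  assumes "finite overlap_types" "\<not> overlap_coincidence \<sigma> \<beta> l \<T>"
  obtains i j z where "bad (i, j, z)"
proof -
  have "\<exists>t. bad t"
  proof (rule ccontr)
    assume none: "\<nexists>t. bad t"
    have "\<forall>t\<in>overlap_types. \<forall>\<^sub>F k in sequentially. case t of (i, j, z) \<Rightarrow> agree k i j z"
    proof
      fix t assume t: "t \<in> overlap_types"
      obtain i j z where tt: "t = (i, j, z)" by (cases t)
      have "\<not> bad (i, j, z)" using none by blast
      then obtain k where "agree k i j z" using t unfolding tt bad.simps by blast
      then have "\<forall>k'\<ge>k. agree k' i j z" using agree_mono by blast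
      then show "\<forall>\<^sub>F k in sequentially. case t of (i, j, z) \<Rightarrow> agree k i j z"
        unfolding tt eventually_sequentially by auto
    qed
    from eventually_ball_finite[OF assms(1) this]
    obtain k where "\<And>k'. k \<le> k' \<Longrightarrow> \<forall>(i, j, z)\<in>overlap_types. agree k' i j z"
      unfolding eventually_sequentially by auto
    then have "\<exists>k\<ge>1. \<forall>(i, j, z)\<in>overlap_types. agree k i j z" by (intro exI[of _ "Suc k"]) simp
    then show False using assms(2) overlap_coincidence_iff by blast
  qed
  then show ?thesis using that by (metis prod.collapse)
qed

text \<open>Moving from neighbour to neighbour, the tiles to the right of \<open>x\<close> form an arithmetic progression.\<close>

lemma tiling_single_letter:
  assumes single: "\<And>a b :: 'a. a = b" and x: "til x i \<in> \<T>" "til x' i \<in> \<T>" "x \<le> x'"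
  shows "\<exists>n::nat. x' - x = n * l $ i"
proof -
  have step: "til (x + real n * l $ i) i \<in> \<T>" for n
  proof (induction n)
    case (Suc n)
    obtain j where "til (x + real n * l $ i + l $ i) j \<in> \<T>" using right_neighbour[OF Suc] by blast
    then show ?case using single[of j i] by (simp add: algebra_simps)
  qed (use x in simp)
  define n where "n = nat \<lfloor>(x' - x) / l $ i\<rfloor>"
  have "0 \<le> (x' - x) / l $ i" using x(3) length_pos[of i] by simp
  then have "real n \<le> (x' - x) / l $ i" "(x' - x) / l $ i < real n + 1"
    unfolding n_def by linarith+
  then have "real n * l $ i \<le> x' - x" "x' - x < (real n + 1) * l $ i"
    using length_pos[of i] by (simp_all add: field_simps)
  then have "x + real n * l $ i = x'"
    using tiling_disjoint[OF step[of n] x(2)] length_pos[of i] by (simp add: algebra_simps)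
  then show ?thesis by (intro exI[of _ n]) simp
qed

text \<open>With only one letter \<open>\<T>\<close> is periodic, so offsets are multiples of the single tile length, and an
  overlap can only have the offset \<open>0\<close>.\<close>

lemma bad_two_letters:
  assumes "bad (i, j, z)"
  shows "\<exists>a b :: 'a. a \<noteq> b"
proof (rule ccontr)
  assume "\<nexists>a b :: 'a. a \<noteq> b"
  then have single: "a = b" for a b :: 'a by blast
  have mult: "\<exists>k::int. x' - x = k * l $ i" if xx': "til x i \<in> \<T>" "til x' i \<in> \<T>" for x x'
  proof (cases "x \<le> x'")
    case True
    from tiling_single_letter[OF single xx' True] show ?thesis by (metis of_int_of_nat_eq)
  next
    case False
    then obtain n :: nat where "x - x' = n * l $ i"
      using tiling_single_letter[OF single xx'(2,1)] by auto
    then have "x' - x = of_int (- int n) * l $ i" by simp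
    then show ?thesis by blast
  qed
  obtain x y where x: "til x i \<in> \<T>" "til (x + z + y) j \<in> \<T>" "y \<in> Xi" "overlapping i j z"
    using assms unfolding bad.simps overlap_types_def by blast
  obtain t c where "til t c \<in> \<T>" "til (t + y) c \<in> \<T>" using x(3) return_vectors_iff by blast
  then obtain k1 :: int where k1: "y = k1 * l $ i" using mult[of t "t + y"] single[of c i] by auto
  obtain k2 :: int where "z + y = k2 * l $ i" using mult[OF x(1), of "x + z + y"] x(2) single[of j i] by auto
  then have z: "z = of_int (k2 - k1) * l $ i" using k1 by (simp add: algebra_simps)
  have "\<bar>z\<bar> < 1 * l $ i" using x(4) single[of j i] by (auto simp: overlapping_def)
  then have "\<bar>of_int (k2 - k1) :: real\<bar> < 1"
    unfolding z abs_mult using length_pos[of i] by (simp add: mult_less_cancel_right_disj)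
  then have "k2 - k1 = 0" by linarith
  then have "z = 0" using z by simp
  then show False using assms agree_refl[of 0 i] single[of j i] by simp
qed

text \<open>Deep inside the inflated overlap the first tiling contains two adjacent tiles \<open>D\<close> and \<open>E\<close> of different
  colours \<open>d\<close> and \<open>e\<close>, meeting at a point \<open>q\<close>. A tile of the second tiling with \<open>q\<close> in its interior overlaps both,
  so one of the two overlaps has different colours. If instead it has \<open>q\<close> as an endpoint, it overlaps the tile
  on its side of \<open>q\<close> with that endpoint in common, and equal colours would make it a coincidence.\<close>

lemma bad_distinct_descendant:
  assumes bad: "bad (i, j, z)"
  shows "\<exists>m i' j' z'. 1 \<le> m \<and> descend m (i, j, z) (i', j', z') \<and> bad (i', j', z') \<and> i' \<noteq> j'"
proof -
  obtain x y where x: "til x i \<in> \<T>" "til (x + z + y) j \<in> \<T>" "y \<in> Xi" and ov: "overlapping i j z"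
    using bad unfolding bad.simps overlap_types_def by blast
  define x' where "x' = x + z + y"
  have x': "til x' j \<in> \<T>" using x(2) by (simp add: x'_def)
  define a b where "a = max x (x' - y)" and "b = min (x + l $ i) (x' - y + l $ j)"
  have ab: "a < b" "x \<le> a" "b \<le> x + l $ i" "x' - y \<le> a" "b \<le> x' - y + l $ j"
    using ov length_pos[of i] length_pos[of j] by (auto simp: a_def b_def x'_def overlapping_def)
  obtain k0 where k0: "\<And>k. k0 \<le> k \<Longrightarrow>
      \<exists>s c. til s c \<in> pat (\<beta> ^ k * x) (iter k [i]) \<and> \<beta> ^ k * a < s \<and> s + l $ c < \<beta> ^ k * b"
    using inflated_interval_contains_tile[OF ab(1-3)] by meson
  define k where "k = Suc k0"
  obtain s c where s: "til s c \<in> pat (\<beta> ^ k * x) (iter k [i])" "\<beta> ^ k * a < s" "s + l $ c < \<beta> ^ k * b"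
    using k0[of k] by (auto simp: k_def)
  obtain K where K: "\<And>e. e \<in> set (iter K [c])" using primitive by blast
  obtain d0 e0 :: 'a where "d0 \<noteq> e0" using bad_two_letters[OF bad] by blast
  then obtain u d e v where w: "iter K [c] = u @ d # e # v" "d \<noteq> e"
    using adjacent_distinct[OF K K] by blast
  define m where "m = K + k"
  have sub: "pat (\<beta> ^ K * s) (iter K [c]) \<subseteq> pat (\<beta> ^ m * x) (iter m [i])"
    using patch_iter[OF s(1), of K] by (simp add: m_def funpow_add power_add mult.assoc)
  define p where "p = \<beta> ^ K * s + len u"
  define q where "q = p + l $ d"
  have D': "til p d \<in> pat (\<beta> ^ K * s) (iter K [c])" and E': "til q e \<in> pat (\<beta> ^ K * s) (iter K [c])"
    unfolding w(1) p_def q_def by simp_all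
  have D: "til p d \<in> pat (\<beta> ^ m * x) (iter m [i])" and E: "til q e \<in> pat (\<beta> ^ m * x) (iter m [i])"
    using D' E' sub by blast+
  have "\<beta> ^ m * a < p" "p < q" "q + l $ e < \<beta> ^ m * b"
  proof -
    have "\<beta> ^ m * a < \<beta> ^ K * s" using s(2) pow_pos[of K] by (simp add: m_def power_add mult.assoc)
    then show "\<beta> ^ m * a < p" using len_nonneg[of u] by (simp add: p_def)
    show "p < q" using length_pos[of d] by (simp add: q_def)
    have "q + l $ e \<le> \<beta> ^ K * (s + l $ c)" using patch_bounds(2)[OF E'] by (simp add: len_iter distrib_left)
    also have "\<dots> < \<beta> ^ m * b" using s(3) pow_pos[of K] by (simp add: m_def power_add mult.assoc)
    finally show "q + l $ e < \<beta> ^ m * b" .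
  qed
  then have q: "\<beta> ^ m * a < q" "q < \<beta> ^ m * b" "p < q" "q < q + l $ e"
    using length_pos[of e] by linarith+
  define Y where "Y = \<beta> ^ m * y"
  \<comment> \<open>The second tiling is \<open>\<T> - Y\<close>; one of its tiles contains the common endpoint \<open>q\<close>.\<close>
  obtain r f where r: "til r f \<in> \<T>" "r \<le> q + Y" "q + Y \<le> r + l $ f" by (rule tiling_cover)
  have F: "til r f \<in> pat (\<beta> ^ m * x') (iter m [j])"
  proof (rule patch_unique[OF x' r(1)])
    have "\<beta> ^ m * b \<le> \<beta> ^ m * (x' - y + l $ j)" using ab(5) pow_pos[of m] by simp
    then show "r < \<beta> ^ m * (x' + l $ j)" using r(2) q(2) by (simp add: Y_def algebra_simps)
    have "\<beta> ^ m * (x' - y) \<le> \<beta> ^ m * a" using ab(4) pow_pos[of m] by simp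
    then show "\<beta> ^ m * x' < r + l $ f" using r(3) q(1) by (simp add: Y_def algebra_simps)
  qed
  have desc: "descend m (i, j, z) (g, f, r - Y - t)" if G: "til t g \<in> pat (\<beta> ^ m * x) (iter m [i])" for t g
  proof -
    obtain u1 v1 where "iter m [i] = u1 @ g # v1" "t = \<beta> ^ m * x + len u1"
      using G by (elim patch_elim) simp
    moreover obtain u2 v2 where "iter m [j] = u2 @ f # v2" "r = \<beta> ^ m * x' + len u2"
      using F by (elim patch_elim) simp
    ultimately show ?thesis unfolding descend.simps
      by (intro exI[of _ u1] exI[of _ v1] exI[of _ u2] exI[of _ v2])
         (simp add: Y_def x'_def algebra_simps)
  qed
  have no_common: False if G: "til t f \<in> pat (\<beta> ^ m * x) (iter m [i])" and "t = r - Y" for t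
  proof -
    have "til t f \<in> pat (\<beta> ^ m * (x + z)) (iter m [j])"
      using F patch_shift_iff[of r "- Y" f "\<beta> ^ m * x'"] unfolding that(2)
      by (simp add: x'_def Y_def algebra_simps)
    then have "agree m i j z" using G agree_iff by blast
    then show False using bad by simp
  qed
  have m1: "1 \<le> m" by (simp add: m_def k_def)
  have done_D: ?thesis if "d \<noteq> f" "r < q + Y"
  proof -
    have "overlapping d f (r - Y - p)" using \<open>r < q + Y\<close> r(3) q(3) by (simp add: overlapping_def q_def)
    then have "bad (d, f, r - Y - p)" by (rule descend_bad[OF bad desc[OF D]])
    then show ?thesis using m1 desc[OF D] \<open>d \<noteq> f\<close> by blast
  qed
  have done_E: ?thesis if "e \<noteq> f" "q + Y < r + l $ f"
  proof -
    have "overlapping e f (r - Y - q)"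
      using \<open>q + Y < r + l $ f\<close> r(2) q(4) by (simp add: overlapping_def)
    then have "bad (e, f, r - Y - q)" by (rule descend_bad[OF bad desc[OF E]])
    then show ?thesis using m1 desc[OF E] \<open>e \<noteq> f\<close> by blast
  qed
  consider "r < q + Y" "q + Y < r + l $ f" | "r = q + Y" | "q + Y = r + l $ f"
    using r(2,3) by linarith
  then show ?thesis
  proof cases
    case 1
    show ?thesis
    proof (cases "d = f")
      case True
      then have "e \<noteq> f" using w(2) by simp
      then show ?thesis using 1(2) by (rule done_E)
    next
      case False
      then show ?thesis using 1(1) by (rule done_D)
    qed
  next
    case 2
    have "e \<noteq> f"
    proof
      assume "e = f"
      then have "til q f \<in> pat (\<beta> ^ m * x) (iter m [i])" using E by simp
      then show False by (rule no_common) (simp add: 2)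
    qed
    moreover have "q + Y < r + l $ f" using length_pos[of f] by (simp add: 2)
    ultimately show ?thesis by (rule done_E)
  next
    case 3
    have "d \<noteq> f"
    proof
      assume "d = f"
      then have "til p f \<in> pat (\<beta> ^ m * x) (iter m [i])" using D by simp
      moreover have "p = r - Y" using 3 \<open>d = f\<close> by (simp add: q_def)
      ultimately show False by (rule no_common)
    qed
    moreover have "r < q + Y" using length_pos[of f] by (simp add: 3)
    ultimately show ?thesis by (rule done_D)
  qed
qed

text \<open>Being a proper descendant is a transitive relation on the finite set of bad types with different
  colours, and every element has a successor; so some element is its own descendant.\<close>

lemma bad_cycle:
  assumes fin: "finite overlap_types" and noc: "\<not> overlap_coincidence \<sigma> \<beta> l \<T>"
  obtains n i j z where "1 \<le> n" "descend n (i, j, z) (i, j, z)" "bad (i, j, z)" "i \<noteq> j"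
proof -
  define B where "B = {t. bad t \<and> fst t \<noteq> fst (snd t)}"
  define R where "R t t' \<longleftrightarrow> (\<exists>m\<ge>1. descend m t t')" for t t'
  have succ: "\<exists>t'\<in>B. R t t'" if bt: "bad t" for t
  proof -
    obtain i j z where t: "t = (i, j, z)" by (cases t)
    obtain m i' j' z' where "1 \<le> m" "descend m (i, j, z) (i', j', z')" "bad (i', j', z')" "i' \<noteq> j'"
      using bad_distinct_descendant[OF bt[unfolded t]] by blast
    then show ?thesis unfolding t R_def B_def by (intro bexI[of _ "(i', j', z')"]) auto
  qed
  have "B \<subseteq> overlap_types"
  proof
    fix t assume "t \<in> B"
    then show "t \<in> overlap_types" unfolding B_def by (cases t) simp
  qed
  then have finB: "finite B" using fin by (rule finite_subset)
  obtain i j z where "bad (i, j, z)" using bad_exists[OF fin noc] by blast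
  then have "B \<noteq> {}" using succ by blast
  have trans: "R t t'' " if "R t t'" "R t' t''" for t t' t''
    using that descend_trans unfolding R_def by (meson le_add1 le_trans)
  have "\<exists>t\<in>B. R t t"
  proof (rule ccontr)
    assume irr: "\<not> ?thesis"
    have "\<exists>m\<in>B. \<forall>t\<in>B. t \<noteq> m \<longrightarrow> \<not> R m t"
    proof (rule Finite_Set.bex_max_element[OF finB _ _ \<open>B \<noteq> {}\<close>])
      show "asymp_on B R" using irr trans by (intro asymp_onI) blast
      show "transp_on B R" using trans by (intro transp_onI) blast
    qed
    then obtain t0 where t0: "t0 \<in> B" "\<forall>t\<in>B. t \<noteq> t0 \<longrightarrow> \<not> R t0 t" by blast
    have "bad t0" using t0(1) by (simp add: B_def)
    then obtain t' where t': "t' \<in> B" "R t0 t'" using succ by blast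
    then have "t' \<noteq> t0" using irr by blast
    with t0(2) t' show False by blast
  qed
  then obtain t where "t \<in> B" "R t t" by blast
  obtain i j z where t: "t = (i, j, z)" by (cases t)
  obtain m where "1 \<le> m" "descend m (i, j, z) (i, j, z)"
    using \<open>R t t\<close> unfolding R_def t by blast
  moreover have "bad (i, j, z)" "i \<noteq> j" using \<open>t \<in> B\<close> unfolding B_def t by simp_all
  ultimately show ?thesis by (rule that)
qed

text \<open>After \<open>k0\<close> steps every letter expands to at least two letters, hence after \<open>2 * k0\<close> steps there is a letter
  in the interior of the word, and after \<open>k0\<close> more steps every letter occurs in the image of that one.\<close>

lemma iter_interior_letter:
  assumes "\<exists>a b :: 'a. a \<noteq> b"
  shows "\<exists>N0. \<forall>N\<ge>N0. \<forall>i c. \<exists>u v. iter N [i] = u @ c # v \<and> u \<noteq> [] \<and> v \<noteq> []"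
proof -
  obtain a b :: 'a where ab: "a \<noteq> b" using assms by blast
  obtain k0 where k0: "\<And>k i j. k0 \<le> k \<Longrightarrow> i \<in> set (iter k [j])" using eventually_all_letters by blast
  have two: "\<exists>p1 p2 r. iter k0 [i] = p1 # p2 # r" for i
  proof -
    have "a \<in> set (iter k0 [i])" "b \<in> set (iter k0 [i])" using k0 by simp_all
    from adjacent_distinct[OF this ab] obtain u a' b' v where "iter k0 [i] = u @ a' # b' # v" by blast
    then show ?thesis by (cases u; cases "tl u") auto
  qed
  have "\<exists>u v. iter N [i] = u @ c # v \<and> u \<noteq> [] \<and> v \<noteq> []" if N: "k0 + (k0 + k0) \<le> N" for N i c
  proof -
    obtain p1 p2 r where p: "iter k0 [i] = p1 # p2 # r" using two by blast
    obtain s1 s2 s where s: "iter k0 [p1] = s1 # s2 # s" using two by blast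
    obtain t1 t2 t where t: "iter k0 [p2] = t1 # t2 # t" using two by blast
    have "iter (k0 + k0) [i] = iter k0 ([p1] @ [p2] @ r)" by (simp add: funpow_add p)
    also have "\<dots> = [s1] @ s2 # (s @ t1 # t2 # t @ iter k0 r)"
      unfolding iter_append s t by simp
    finally have w: "iter (k0 + k0) [i] = [s1] @ s2 # (s @ t1 # t2 # t @ iter k0 r)" .
    define q where "q = N - (k0 + k0)"
    have qN: "q + (k0 + k0) = N" "k0 \<le> q" using N by (simp_all add: q_def)
    obtain u v where uv: "iter q [s2] = u @ c # v" using k0[OF qN(2)] by (meson split_list)
    have "iter N [i] = (iter q [s1] @ u) @ c # (v @ iter q (s @ t1 # t2 # t @ iter k0 r))"
      using iter_descend[OF w uv] unfolding qN(1) .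
    moreover have "iter q [s1] @ u \<noteq> []" using iter_nonempty by simp
    moreover have "iter q (s @ t1 # t2 # t @ iter k0 r) \<noteq> []"
      using iter_split[of q \<sigma> s t1 "t2 # t @ iter k0 r"] iter_nonempty[of q t1] by simp
    ultimately show ?thesis by blast
  qed
  then show ?thesis by blast
qed

end

section \<open>Control points from a cycle\<close>

context suspension
begin

text \<open>The tile map places the selected tile at the prefix \<open>F i\<close> with colour \<open>G i\<close>. For \<open>a\<close> and \<open>b\<close> it follows the
  cycle, so the overlap \<open>(a, b, z)\<close> is mapped to a translate of itself and its two control points coincide after
  the shift by the return vector. All other letters select a tile of colour \<open>a\<close> with nonempty words on both
  sides; their control points are interior, so they do not restrict admissibility, and contractions of control
  points of colour \<open>a\<close>, so the differences stay in the group.\<close>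

lemma cycle_not_multiple:
  assumes N1: "1 \<le> N" and cyc: "descend N (a, b, z) (a, b, z)" and bad: "bad (a, b, z)" and ab: "a \<noteq> b"
    and int: "\<And>i c. \<exists>u v. iter N [i] = u @ c # v \<and> u \<noteq> [] \<and> v \<noteq> []"
  shows "\<not> multiple_strong_coincidence \<sigma> \<beta> l \<T> N"
proof -
  obtain u v u' v' where ua: "iter N [a] = u @ a # v" and ub: "iter N [b] = u' @ b # v'"
    and z: "z = \<beta> ^ N * z + len u' - len u"
    using cyc unfolding descend.simps by blast
  obtain p q where pq: "\<And>i. iter N [i] = p i @ a # q i" "\<And>i. p i \<noteq> []" "\<And>i. q i \<noteq> []"
    using int[of _ a] by metis
  define F where "F i = (if i = a then u else if i = b then u' else p i)" for i
  define G where "G i = (if i = b then b else a)" for i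
  define H where "H i = (if i = a then v else if i = b then v' else q i)" for i
  have split: "iter N [i] = F i @ G i # H i" for i
  proof -
    consider "i = a" | "i = b" | "i \<noteq> a" "i \<noteq> b" by blast
    then show ?thesis
    proof cases
      case 1
      then show ?thesis using ua ab by (simp add: F_def G_def H_def)
    next
      case 2
      then show ?thesis using ub ab by (simp add: F_def G_def H_def)
    next
      case 3
      then show ?thesis using pq(1)[of i] by (simp add: F_def G_def H_def)
    qed
  qed
  define \<gamma> where "\<gamma> T = til (\<beta> ^ N * Inf (supp T) + len (F (color T))) (G (color T))" for T
  have \<gamma>: "\<gamma> (til x i) = til (\<beta> ^ N * x + len (F i)) (G i)" for x i
    using length_pos[of i] by (simp add: \<gamma>_def less_imp_le)
  have tm: "tile_map \<sigma> \<beta> l \<T> N \<gamma>"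
    unfolding tile_map_def
  proof (intro conjI ballI allI impI)
    fix T assume T: "T \<in> \<T>"
    then obtain x i where x: "T = til x i" using tiling_tile by blast
    show "\<gamma> T \<in> \<T>" unfolding x \<gamma> using T x split by (intro patch_tile_in_tiling) auto
    show "\<gamma> T \<in> (Omega ^^ N) {T}"
      unfolding x \<gamma> tile_subst_pow_tile split[of i] by (rule patch_split)
    fix T' y assume "T' \<in> \<T>" "T' = shift y T"
    then have "T' = til (x + y) i" by (simp add: x add.commute)
    then show "\<gamma> T' = shift (\<beta> ^ N * y) (\<gamma> T)" unfolding x by (simp add: \<gamma> algebra_simps)
  qed
  interpret tile_mapped \<sigma> \<beta> l \<T> N \<gamma> using tm N1 by unfold_locales
  obtain base where base: "\<And>i. til (base i) i \<in> \<T>" using all_colors by metis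
  define c where "c i = cp (til (base i) i) - base i" for i
  have cp: "cp (til x i) = x + c i" if "til x i \<in> \<T>" for x i
    using cp_shift_tile[OF base that] by (simp add: c_def)
  have fixpoint: "\<beta> ^ N * c i = len (F i) + c (G i)" for i
  proof -
    have "til (\<beta> ^ N * base i + len (F i)) (G i) \<in> \<T>"
      by (rule patch_tile_in_tiling[OF base split])
    from cp[OF this] cp_map[OF base[of i]] show ?thesis
      by (simp add: \<gamma> cp[OF base] algebra_simps)
  qed
  have c_bounds: "0 \<le> c i" "c i \<le> l $ i" for i
    using cp_supp[OF base[of i]] by (simp_all add: c_def)
  \<comment> \<open>The offset \<open>z\<close> and the difference of the two control points satisfy the same affine equation.\<close>
  have cz: "c a - c b = z"
  proof -
    have "\<beta> ^ N * c a = len u + c a" "\<beta> ^ N * c b = len u' + c b"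
      using fixpoint[of a] fixpoint[of b] ab by (simp_all add: F_def G_def)
    then have "(\<beta> ^ N - 1) * (c a - c b) = len u - len u'" by (simp add: algebra_simps)
    also have "\<dots> = (\<beta> ^ N - 1) * z" using z by (simp add: algebra_simps)
    finally have "(\<beta> ^ N - 1) * (c a - c b - z) = 0" by (simp add: algebra_simps)
    moreover have "1 < \<beta> ^ N" using expanding N1 by simp
    ultimately show ?thesis by simp
  qed
  have c_inner: "0 < c i" "c i < l $ i" if i: "i \<noteq> a" "i \<noteq> b" for i
  proof -
    have e: "\<beta> ^ N * c i = len (p i) + c a" using fixpoint[of i] i by (simp add: F_def G_def)
    have "0 < \<beta> ^ N * c i" using e len_pos[OF pq(2)[of i]] c_bounds(1)[of a] by linarith
    then show "0 < c i" by (rule zero_less_mult_pos[OF _ pow_pos])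
    have "\<beta> ^ N * l $ i = len (p i) + l $ a + len (q i)"
      using len_iter[of N "[i]"] pq(1)[of i] by simp
    then have "\<beta> ^ N * c i < \<beta> ^ N * l $ i"
      using e len_pos[OF pq(3)[of i]] c_bounds(2)[of a] by linarith
    then show "c i < l $ i" by (rule mult_less_cancel_left_pos[OF pow_pos, THEN iffD1])
  qed
  have offset: "base j - (cp (til (base j) j) - cp (til (base i) i)) - base i = c i - c j" for i j
    by (simp add: c_def)
  obtain x0 y where x0: "til x0 a \<in> \<T>" "til (x0 + z + y) b \<in> \<T>" "y \<in> Xi" and ov: "overlapping a b z"
    using bad unfolding bad.simps overlap_types_def by blast
  have adm: "admissible \<beta> l \<T> N \<gamma>"
    unfolding admissible_iff[OF base] offset
  proof (intro allI)
    have lt: "c i - c j < l $ i" for i j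
    proof -
      consider "i = j" | "i = a" "j = b" | "i = b" "j = a" | "i \<noteq> a" "i \<noteq> b" | "j \<noteq> a" "j \<noteq> b"
        by blast
      then show ?thesis
      proof cases
        case 1
        then show ?thesis using length_pos[of i] by simp
      next
        case 2
        then show ?thesis using ov cz by (simp add: overlapping_def)
      next
        case 3
        then show ?thesis using ov cz by (simp add: overlapping_def)
      next
        case 4
        then show ?thesis using c_inner(2)[of i] c_bounds(1)[of j] by linarith
      next
        case 5
        then show ?thesis using c_inner(1)[of j] c_bounds(2)[of i] by linarith
      qed
    qed
    show "overlapping i j (c i - c j)" for i j
      using lt[of i j] lt[of j i] by (simp add: overlapping_def)
  qed
  let ?\<Lambda> = "color_points \<beta> \<T> N \<gamma>"
  let ?G = "group_closure (return_generators \<beta> \<T> N \<gamma> a)"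
  have gen: "(p - q) / \<beta> ^ k \<in> ?G" if "p \<in> ?\<Lambda> a" "q \<in> ?\<Lambda> a" for p q k
  proof (rule group_closure.base)
    show "(p - q) / \<beta> ^ k \<in> insert 0 (return_generators \<beta> \<T> N \<gamma> a)"
      using that unfolding return_generators_def by blast
  qed
  have pt: "cp (til x i) \<in> ?\<Lambda> i" if "til x i \<in> \<T>" for x i
    using that unfolding color_points_eq by blast
  have ret: "y \<in> ?G" if yXi: "y \<in> Xi" for y
  proof -
    obtain x d where x: "til x d \<in> \<T>" "til (x + y) d \<in> \<T>" using yXi return_vectors_iff by blast
    obtain k where "a \<in> set (iter k [d])" using primitive by blast
    then obtain w1 w2 where w: "iter k [d] = w1 @ a # w2" by (meson split_list)
    have t: "til (\<beta> ^ k * x + len w1) a \<in> \<T>" "til (\<beta> ^ k * (x + y) + len w1) a \<in> \<T>"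
      by (rule patch_tile_in_tiling[OF _ w], rule x)+
    have "(cp (til (\<beta> ^ k * (x + y) + len w1) a) - cp (til (\<beta> ^ k * x + len w1) a)) / \<beta> ^ k = y"
      unfolding cp[OF t(1)] cp[OF t(2)] using expanding by (simp add: field_simps)
    then show ?thesis using gen[OF pt[OF t(2)] pt[OF t(1)], of k] by simp
  qed
  have near: "r - cp (til x0 a) \<in> ?G" if rj: "r \<in> ?\<Lambda> j" for r j
  proof -
    obtain x where x: "til x j \<in> \<T>" "r = cp (til x j)" using rj unfolding color_points_eq by blast
    show ?thesis
    proof (cases "j = b")
      case True
      have "r - cp (til (x0 + z + y) b) \<in> Xi"
        using same_color_difference[OF _ pt[OF x0(2)], of r] rj True by simp
      then have "r - cp (til (x0 + z + y) b) + y \<in> ?G" by (intro group_closure_add ret x0(3))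
      moreover have "cp (til (x0 + z + y) b) - y = cp (til x0 a)"
        using cp[OF x0(1)] cp[OF x0(2)] cz by simp
      ultimately show ?thesis by (simp add: algebra_simps)
    next
      case False
      then have Gj: "G j = a" "G a = a" using ab by (simp_all add: G_def)
      have t: "til (\<beta> ^ N * x + len (F j)) a \<in> \<T>" "til (\<beta> ^ N * x0 + len (F a)) a \<in> \<T>"
        using patch_tile_in_tiling[OF x(1) split] patch_tile_in_tiling[OF x0(1) split] Gj by simp_all
      have "\<gamma> (til x j) = til (\<beta> ^ N * x + len (F j)) a" "\<gamma> (til x0 a) = til (\<beta> ^ N * x0 + len (F a)) a"
        unfolding \<gamma> Gj by simp_all
      then have "\<beta> ^ N * (r - cp (til x0 a))
          = cp (til (\<beta> ^ N * x + len (F j)) a) - cp (til (\<beta> ^ N * x0 + len (F a)) a)"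
        using cp_map[OF x(1)] cp_map[OF x0(1)] x(2) by (simp add: right_diff_distrib)
      then have "r - cp (til x0 a)
          = (cp (til (\<beta> ^ N * x + len (F j)) a) - cp (til (\<beta> ^ N * x0 + len (F a)) a)) / \<beta> ^ N"
        using pow_pos[of N] by (metis less_irrefl nonzero_mult_div_cancel_left)
      then show ?thesis using gen[OF pt[OF t(1)] pt[OF t(2)], of N] by simp
    qed
  qed
  have sub: "{r - s |r s. r \<in> (\<Union>j. ?\<Lambda> j) \<and> s \<in> (\<Union>j. ?\<Lambda> j)} \<subseteq> ?G"
  proof clarify
    fix r s i j assume "r \<in> ?\<Lambda> i" "s \<in> ?\<Lambda> j"
    from group_closure.diff[OF near[OF this(1)] near[OF this(2)]] show "r - s \<in> ?G" by simp
  qed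
  have "\<not> strong_coincidence \<sigma> \<beta> l \<T> N \<gamma>"
  proof
    assume "strong_coincidence \<sigma> \<beta> l \<T> N \<gamma>"
    then obtain L where "agree L a b z"
      unfolding strong_coincidence_iff[OF base] offset using cz by metis
    then show False using bad by simp
  qed
  then show ?thesis unfolding multiple_strong_coincidence_def using tm adm sub by blast
qed

lemma not_multiple_exists:
  assumes "finite overlap_types" "\<not> overlap_coincidence \<sigma> \<beta> l \<T>"
  shows "\<exists>n\<ge>1. \<not> multiple_strong_coincidence \<sigma> \<beta> l \<T> n"
proof -
  obtain n a b z where n: "1 \<le> n" "descend n (a, b, z) (a, b, z)" and bad: "bad (a, b, z)" and ab: "a \<noteq> b"
    by (rule bad_cycle[OF assms])
  have "\<exists>a b :: 'a. a \<noteq> b" using ab by blast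
  from iter_interior_letter[OF this] obtain N0 where
    N0: "\<And>N i c. N0 \<le> N \<Longrightarrow> \<exists>u v. iter N [i] = u @ c # v \<and> u \<noteq> [] \<and> v \<noteq> []" by blast
  define N where "N = n * Suc N0"
  have N: "1 \<le> N" "N0 \<le> N" using n(1) by (simp_all add: N_def trans_le_add2)
  have "\<not> multiple_strong_coincidence \<sigma> \<beta> l \<T> N"
    using N(1) descend_pow[OF n(2)] bad ab N0[OF N(2)] unfolding N_def by (intro cycle_not_multiple)
  then show ?thesis using N(1) by blast
qed

end

section \<open>Substitution matrices and word iterates\<close>

lemma word_length_eq_count:
  fixes w :: "'a::finite list"
  shows "word_length l w = (\<Sum>i\<in>UNIV. real (count_list w i) * l $ i)"
proof (induction w)
  case (Cons c w)
  have "(\<Sum>i\<in>UNIV. real (count_list (c # w) i) * l $ i)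
      = (\<Sum>i\<in>UNIV. (if i = c then l $ i else 0) + real (count_list w i) * l $ i)"
    by (intro sum.cong) (auto simp: algebra_simps)
  then show ?case using Cons by (simp add: sum.distrib)
qed simp

lemma count_subst_word:
  fixes w :: "'a::finite list"
  shows "real (count_list (subst_word \<sigma> w) i) = (\<Sum>j\<in>UNIV. real (count_list (\<sigma> j) i) * real (count_list w j))"
proof (induction w)
  case (Cons c w)
  have "(\<Sum>j\<in>UNIV. real (count_list (\<sigma> j) i) * real (count_list (c # w) j))
      = (\<Sum>j\<in>UNIV. (if j = c then real (count_list (\<sigma> j) i) else 0)
           + real (count_list (\<sigma> j) i) * real (count_list w j))"
    by (intro sum.cong) (auto simp: algebra_simps)
  then show ?case using Cons by (simp add: sum.distrib)
qed simp

text \<open>Iterated matrix products count letters in iterated words, so primitivity of the matrix says that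
  every letter occurs in a common iterate of all letters.\<close>

lemma subst_matrix_pow:
  "(((**) (subst_matrix \<sigma>) ^^ k) (mat 1)) $ i $ j = real (count_list ((subst_word \<sigma> ^^ k) [j]) i)"
proof (induction k arbitrary: i)
  case (Suc k)
  have "(((**) (subst_matrix \<sigma>) ^^ Suc k) (mat 1)) $ i $ j
      = (\<Sum>h\<in>UNIV. subst_matrix \<sigma> $ i $ h * (((**) (subst_matrix \<sigma>) ^^ k) (mat 1)) $ h $ j)"
    by (simp add: matrix_matrix_mult_def)
  also have "\<dots> = (\<Sum>h\<in>UNIV. real (count_list (\<sigma> h) i) * real (count_list ((subst_word \<sigma> ^^ k) [j]) h))"
    unfolding Suc by (simp add: subst_matrix_def)
  finally show ?case by (simp add: count_subst_word)
qed (simp add: mat_def)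

theorem corollary3p3:
  fixes \<sigma> :: "'a::finite \<Rightarrow> 'a list"
    and \<beta> :: real
    and l :: "real^'a"
    and \<T> :: "'a tile set"
  assumes "substitution \<sigma>"
    and "primitive_matrix (subst_matrix \<sigma>)"
    and "perron_root (subst_matrix \<sigma>) \<beta>"
    and "pisot_number \<beta>"
    and "\<And>i. 0 < l $ i"
    and "l v* subst_matrix \<sigma> = \<beta> *s l"
    and "suspension_tiling \<sigma> \<beta> l \<T>"
  shows "\<exists>n\<ge>1. multiple_strong_coincidence \<sigma> \<beta> l \<T> n \<longleftrightarrow> overlap_coincidence \<sigma> \<beta> l \<T>"
proof -
  interpret pisot_suspension \<sigma> \<beta> l \<T>
  proof
    show "1 < \<beta>" using assms(4) by (simp add: pisot_number_def)
    show "word_length l (\<sigma> j) = \<beta> * l $ j" for j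
    proof -
      have "(l v* subst_matrix \<sigma>) $ j = (\<Sum>i\<in>UNIV. real (count_list (\<sigma> j) i) * l $ i)"
        by (simp add: vector_matrix_mult_def subst_matrix_def mult.commute)
      then show ?thesis unfolding word_length_eq_count using assms(6) by simp
    qed
    obtain k where "\<And>i j. 0 < (((**) (subst_matrix \<sigma>) ^^ k) (mat 1)) $ i $ j"
      using assms(2) unfolding primitive_matrix_def by blast
    then have "\<forall>i j. i \<in> set ((subst_word \<sigma> ^^ k) [j])"
      unfolding subst_matrix_pow by (metis count_notin less_irrefl of_nat_0)
    then show "\<exists>k. \<forall>i j. i \<in> set ((subst_word \<sigma> ^^ k) [j])" by blast
  qed (use assms in auto)
  show ?thesis
  proof (cases "overlap_coincidence \<sigma> \<beta> l \<T>")
    case True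
    then have "multiple_strong_coincidence \<sigma> \<beta> l \<T> 1" by (rule overlap_coincidence_imp_multiple) simp
    then show ?thesis using True by (intro exI[of _ 1]) simp
  next
    case False
    then show ?thesis using not_multiple_exists[OF finite_overlap_types] by blast
  qed
qed

end
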